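(* Let $d\ge 2$, let $k\in\mathbb{R}\setminus\{0\}$, let $\mathbb{M}_k^d$ be the $d$-dimensional standard space of constant curvature $k$, and let $L\subset\mathbb{M}_k^d$ be a totally geodesic hypersurface. Let $\xi_d$ be the isometry-invariant random ball process in $\mathbb{M}_k^d$ with intensity $N_d\in(0,\infty)$ and radius distribution $\nu_d$, and let $\xi_{d-1}$ be the process of balls it induces in $L$, with intensity $N_{d-1}\in(0,\infty)$ and radius distribution $\nu_{d-1}$ (all as defined in the context). Then for every $r\in[0,l_k]$, $$N_{d-1}\,\nu_{d-1}((r,l_k]) = N_d \int_r^{l_k} \int_{-\alpha_k(R,r)}^{\alpha_k(R,r)} \cos^{d-1}(\sqrt{k}\,h)\,\mathrm{d}h\,\nu_d(\mathrm{d}R).$$ Specifically, for the ratio of the intensity parameters, $$\frac{N_{d-1}}{N_d}=\int_0^{l_k} \int_{-R}^{R} \cos^{d-1}(\sqrt{k}\,h)\,\mathrm{d}h\,\nu_d(\mathrm{d}R).$$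
   Context: Space. For $k>0$, $\mathbb{M}_k^d$ is the sphere of radius $1/\sqrt{k}$ in $\mathbb{R}^{d+1}$; for $k<0$ it is the $d$-dimensional hyperbolic space of constant sectional curvature $k$. It carries its geodesic distance and Riemannian volume measure $\mu_{k,d}$. A totally geodesic hypersurface $L$ is a great subsphere ($k>0$) or a hyperbolic hyperplane ($k<0$) of dimension $d-1$; $\mu_{k,L}$ is its Riemannian volume measure. Conventions. $l_k:=\frac{\pi}{2\sqrt{k}}$ if $k>0$ and $l_k:=\infty$ if $k<0$. If $k<0$, the intervals $(r,l_k]$ and $[r,l_k]$ mean $(r,\infty)$ and $[r,\infty)$. The symbol $\cos(\sqrt{k}\,h)$ means the usual cosine if $k>0$ and $\cosh(\sqrt{-k}\,h)$ if $k<0$. For $0\le |h|\le t\le l_k$ (with $t<\infty$), $$\alpha_k(t,h):=\begin{cases}\frac{1}{\sqrt{-k}}\operatorname{arcosh}\!\left(\frac{\cosh(\sqrt{-k}\,t)}{\cosh(\sqrt{-k}\,h)}\right), & k<0,\\[4pt] \frac{1}{\sqrt{k}}\arccos\!\left(\frac{\cos(\sqrt{k}\,t)}{\cos(\sqrt{k}\,h)}\right), & k>0.\end{cases}$$ Ball process. $\eta_d$ is a point process on $\mathbb{M}_k^d$ whose distribution is invariant under all isometries of $\mathbb{M}_k^d$, with intensity measure $N_d\,\mu_{k,d}$, $N_d\in(0,\infty)$. $\nu_d$ is a probability measure on $(0,\infty)$. $\xi_d$ is the independent $\nu_d$-marking of $\eta_d$ (each point independently gets a mark with law $\nu_d$);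 it has intensity measure $N_d\,\mu_{k,d}\otimes\nu_d$, and a point $(x,R)$ of $\xi_d$ represents the ball $B(x,R)$ with centre $x$ and radius $R$. Induced process. Intersecting with $L$ the balls of $\xi_d$ that hit $L$ gives balls in $L$. Such a ball is represented by (its centre in $L$, its radius), where the centre is the orthogonal projection of $x$ onto $L$. They form the marked point process $\xi_{d-1}$ on $L$. By invariance its intensity measure is written as $N_{d-1}\,\mu_{k,L}\otimes\nu_{d-1}$ with $N_{d-1}\in(0,\infty)$ and $\nu_{d-1}$ a probability measure on $(0,\infty)$.
   Formalization: The formula for the ratio of intensities is proved under the added assumption that the radius distribution gives no mass to radii larger than l_k (automatic for k<0); for k>0 it is false otherwise, since such balls meet L but do not contribute to the right-hand side. *)

theory Defs
  imports "HOL-Probability.Probability"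
begin

section \<open>Spaces of constant curvature\<close>

text \<open>
  Both models live in \<open>(real ^ 'n) \<times> real\<close>, a copy of the (d+1)-dimensional coordinate space with
  \<open>d = CARD('n)\<close>. For \<open>k > 0\<close> the form below is the Euclidean inner product; for \<open>k < 0\<close> it is the
  Minkowski form, with the last coordinate being time. The resulting spaces are the sphere of radius
  \<open>1 / sqrt k\<close> and the upper sheet of the hyperboloid \<open>form k z z = 1 / k\<close>.
\<close>

type_synonym 'n ambient = "(real ^ 'n) \<times> real"

definition form :: "real \<Rightarrow> 'n::finite ambient \<Rightarrow> 'n ambient \<Rightarrow> real" where
  "form k z w = fst z \<bullet> fst w + sgn k * (snd z * snd w)"

definition model_space :: "real \<Rightarrow> 'n::finite ambient set" where
  "model_space k = {z. form k z z = 1 / k \<and> (k < 0 \<longrightarrow> snd z > 0)}"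

definition geodesic_dist :: "real \<Rightarrow> 'n::finite ambient \<Rightarrow> 'n ambient \<Rightarrow> real" where
  "geodesic_dist k x y =
     (if k > 0 then arccos (k * form k x y) / sqrt k
      else arcosh (k * form k x y) / sqrt (- k))"

definition geodesic_ball :: "real \<Rightarrow> 'n::finite ambient \<Rightarrow> real \<Rightarrow> 'n ambient set" where
  "geodesic_ball k x R = {y \<in> model_space k. geodesic_dist k x y \<le> R}"

definition isometry ::
    "real \<Rightarrow> ('n::finite ambient \<Rightarrow> 'n ambient) \<Rightarrow> bool" where
  "isometry k g \<longleftrightarrow> bij_betw g (model_space k) (model_space k) \<and>
     (\<forall>x\<in>model_space k. \<forall>y\<in>model_space k. geodesic_dist k (g x) (g y) = geodesic_dist k x y)"

text \<open>
  Great subspheres and hyperbolic hyperplanes are the nonempty sections by linear hyperplanes of the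
  ambient space. For \<open>k < 0\<close>, nonemptiness says that the linear hyperplane is timelike.
\<close>

definition totally_geodesic_hypersurface :: "real \<Rightarrow> 'n::finite ambient set \<Rightarrow> bool" where
  "totally_geodesic_hypersurface k L \<longleftrightarrow>
     L \<noteq> {} \<and> (\<exists>W. subspace W \<and> dim W = CARD('n) \<and> L = model_space k \<inter> W)"


section \<open>Riemannian volume\<close>

text \<open>
  \<open>S\<close> is a submanifold of the ambient space, of dimension \<open>CARD('m)\<close>, with the Riemannian metric
  obtained by restricting \<open>form k\<close> to its tangent spaces. Its volume measure is the Borel measure given
  in every local parametrization by the density \<open>sqrt (det g)\<close>, \<open>g\<close> being the matrix of the metric.
\<close>

definition local_parametrization ::
    "'e::real_normed_vector set \<Rightarrow> (real ^ 'm::finite) set \<Rightarrow> (real ^ 'm \<Rightarrow> 'e) \<Rightarrow>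
     (real ^ 'm \<Rightarrow> real ^ 'm \<Rightarrow> 'e) \<Rightarrow> bool" where
  "local_parametrization S U \<phi> \<phi>' \<longleftrightarrow>
     open U \<and> openin (top_of_set S) (\<phi> ` U) \<and> (\<exists>\<psi>. homeomorphism U (\<phi> ` U) \<phi> \<psi>) \<and>
     (\<forall>x\<in>U. (\<phi> has_derivative \<phi>' x) (at x) \<and> inj (\<phi>' x)) \<and>
     (\<forall>v. continuous_on U (\<lambda>x. \<phi>' x v))"

definition metric_matrix ::
    "real \<Rightarrow> (real ^ 'm::finite \<Rightarrow> 'n::finite ambient) \<Rightarrow> real ^ 'm ^ 'm" where
  "metric_matrix k D = (\<chi> i j. form k (D (axis i 1)) (D (axis j 1)))"

definition riemannian_volume ::
    "'m::finite itself \<Rightarrow> real \<Rightarrow> 'n::finite ambient set \<Rightarrow> 'n ambient measure \<Rightarrow> bool"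
where
  "riemannian_volume _ k S \<mu> \<longleftrightarrow>
     sets \<mu> = sets (restrict_space borel S) \<and>
     (\<forall>(U :: (real ^ 'm) set) \<phi> \<phi>'. local_parametrization S U \<phi> \<phi>' \<longrightarrow>
        (\<forall>A\<in>sets \<mu>. A \<subseteq> \<phi> ` U \<longrightarrow>
           emeasure \<mu> A =
             (\<integral>\<^sup>+x\<in>U \<inter> \<phi> -` A. ennreal (sqrt (det (metric_matrix k (\<phi>' x)))) \<partial>lborel)))"


section \<open>The functions in the formula\<close>

definition quarter_length :: "real \<Rightarrow> ereal" where
  "quarter_length k = (if k > 0 then ereal (pi / (2 * sqrt k)) else \<infinity>)"

definition cos_curv :: "real \<Rightarrow> real \<Rightarrow> real" where
  "cos_curv k h = (if k > 0 then cos (sqrt k * h) else cosh (sqrt (- k) * h))"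

definition alpha :: "real \<Rightarrow> real \<Rightarrow> real \<Rightarrow> real" where
  "alpha k t h =
     (if k < 0 then arcosh (cosh (sqrt (- k) * t) / cosh (sqrt (- k) * h)) / sqrt (- k)
      else arccos (cos (sqrt k * t) / cos (sqrt k * h)) / sqrt k)"


section \<open>Point processes\<close>

text \<open>
  A point process on a space \<open>S\<close> is a random locally finite counting measure, i.e. a measure-valued
  map on the probability space \<open>P\<close> whose evaluations are random variables. In the spaces used here
  the relatively compact sets are the bounded ones.
\<close>

definition point_process ::
    "'w measure \<Rightarrow> 'a::metric_space measure \<Rightarrow> ('w \<Rightarrow> 'a measure) \<Rightarrow> bool" where
  "point_process P S \<eta> \<longleftrightarrow>
     (\<forall>\<omega>\<in>space P. sets (\<eta> \<omega>) = sets S) \<and>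
     (\<forall>A\<in>sets S. (\<lambda>\<omega>. emeasure (\<eta> \<omega>) A) \<in> borel_measurable P) \<and>
     (\<forall>\<omega>\<in>space P. \<forall>A\<in>sets S. bounded A \<longrightarrow> (\<exists>n::nat. emeasure (\<eta> \<omega>) A = of_nat n))"

text \<open>
  The distribution of a random measure, as a law on set functions with the sigma-algebra generated by
  the evaluations.
\<close>

definition random_measure_law ::
    "'w measure \<Rightarrow> 'a measure \<Rightarrow> ('w \<Rightarrow> 'a measure) \<Rightarrow> ('a set \<Rightarrow> ennreal) measure" where
  "random_measure_law P S \<eta> =
     distr P (Pi\<^sub>M (sets S) (\<lambda>_. borel)) (\<lambda>\<omega>. \<lambda>A\<in>sets S. emeasure (\<eta> \<omega>) A)"

definition isometry_invariant ::
    "'w measure \<Rightarrow> real \<Rightarrow> ('w \<Rightarrow> 'n::finite ambient measure) \<Rightarrow> bool" where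
  "isometry_invariant P k \<eta> \<longleftrightarrow>
     (\<forall>g. isometry k g \<longrightarrow>
        random_measure_law P (restrict_space borel (model_space k))
          (\<lambda>\<omega>. distr (\<eta> \<omega>) (restrict_space borel (model_space k)) g) =
        random_measure_law P (restrict_space borel (model_space k)) \<eta>)"

definition has_intensity_measure ::
    "'w measure \<Rightarrow> ('w \<Rightarrow> 'a measure) \<Rightarrow> 'a measure \<Rightarrow> bool" where
  "has_intensity_measure P \<eta> m \<longleftrightarrow>
     (\<forall>A\<in>sets m. (\<integral>\<^sup>+\<omega>. emeasure (\<eta> \<omega>) A \<partial>P) = emeasure m A)"

text \<open>Probability measures on the positive half-line are Borel measures on the line concentrated there.\<close>

definition radius_distribution :: "real measure \<Rightarrow> bool" where
  "radius_distribution \<nu> \<longleftrightarrow> prob_space \<nu> \<and> sets \<nu> = sets borel \<and> (AE R in \<nu>. 0 < R)"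

text \<open>
  The measure \<open>distr (count_space {i. enat i < \<kappa>}) S x\<close> is the sum of the Dirac measures at the points
  \<open>x i\<close>, \<open>i < \<kappa>\<close>. The process \<open>\<xi>\<close> is an independent \<open>\<nu>\<close>-marking of \<open>\<eta>\<close> if, for some enumeration
  \<open>X i\<close>, \<open>i < \<kappa>\<close>, of the points of \<open>\<eta>\<close>, the point \<open>X i\<close> carries the mark \<open>R i\<close>, where the \<open>R i\<close> are
  i.i.d. with law \<open>\<nu>\<close> and independent of the enumeration; the factorization of the joint law below
  expresses both. Points \<open>X i\<close> with \<open>i \<ge> \<kappa>\<close> are not used.
\<close>

definition independent_marking ::
    "'w measure \<Rightarrow> 'a measure \<Rightarrow> ('w \<Rightarrow> 'a measure) \<Rightarrow> real measure \<Rightarrow>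
     ('w \<Rightarrow> ('a \<times> real) measure) \<Rightarrow> bool" where
  "independent_marking P S \<eta> \<nu> \<xi> \<longleftrightarrow>
     (\<exists>(\<kappa> :: 'w \<Rightarrow> enat) (X :: nat \<Rightarrow> 'w \<Rightarrow> 'a) (R :: nat \<Rightarrow> 'w \<Rightarrow> real).
        \<kappa> \<in> P \<rightarrow>\<^sub>M count_space UNIV \<and> (\<forall>i. X i \<in> P \<rightarrow>\<^sub>M S) \<and> (\<forall>i. R i \<in> P \<rightarrow>\<^sub>M borel) \<and>
        (let E = count_space UNIV \<Otimes>\<^sub>M Pi\<^sub>M UNIV (\<lambda>_. S);
             enum = (\<lambda>\<omega>. (\<kappa> \<omega>, \<lambda>i. X i \<omega>))
         in distr P (E \<Otimes>\<^sub>M Pi\<^sub>M UNIV (\<lambda>_. borel)) (\<lambda>\<omega>. (enum \<omega>, \<lambda>i. R i \<omega>)) =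
              distr P E enum \<Otimes>\<^sub>M Pi\<^sub>M UNIV (\<lambda>_. \<nu>)) \<and>
        (AE \<omega> in P. \<eta> \<omega> = distr (count_space {i. enat i < \<kappa> \<omega>}) S (\<lambda>i. X i \<omega>)) \<and>
        (AE \<omega> in P. \<xi> \<omega> =
           distr (count_space {i. enat i < \<kappa> \<omega>}) (S \<Otimes>\<^sub>M borel) (\<lambda>i. (X i \<omega>, R i \<omega>))))"


section \<open>The induced ball process\<close>

text \<open>
  The orthogonal projection onto \<open>L\<close> is the nearest-point map. It is unique except, for \<open>k > 0\<close>, at
  the two poles of \<open>L\<close>, where an arbitrary point of \<open>L\<close> is chosen.
\<close>

definition orth_proj ::
    "real \<Rightarrow> 'n::finite ambient set \<Rightarrow> 'n ambient \<Rightarrow> 'n ambient" where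
  "orth_proj k L x = arg_min_on (geodesic_dist k x) L"

text \<open>
  The radius of the ball in \<open>L\<close> that is the section of \<open>B(x, R)\<close>. The infimum only matters if the
  section is all of \<open>L\<close> (\<open>k > 0\<close>); in the other cases the radius is unique.
\<close>

definition section_radius ::
    "real \<Rightarrow> 'n::finite ambient set \<Rightarrow> 'n ambient \<Rightarrow> real \<Rightarrow> real" where
  "section_radius k L x R =
     Inf {s. 0 \<le> s \<and> geodesic_ball k x R \<inter> L = geodesic_ball k (orth_proj k L x) s \<inter> L}"

definition induced_process ::
    "real \<Rightarrow> 'n::finite ambient set \<Rightarrow> ('w \<Rightarrow> ('n ambient \<times> real) measure) \<Rightarrow>
     'w \<Rightarrow> ('n ambient \<times> real) measure" where
  "induced_process k L \<xi> \<omega> =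
     distr (restrict_space (\<xi> \<omega>) {(x, R). geodesic_ball k x R \<inter> L \<noteq> {}})
       (restrict_space borel L \<Otimes>\<^sub>M borel)
       (\<lambda>(x, R). (orth_proj k L x, section_radius k L x R))"

end

theory Submission
  imports Defs
begin

text \<open>
  Let \<open>n\<close> be the unit normal of the linear hyperplane spanned by \<open>L\<close>. Every point of the space is, away
  from the poles of \<open>L\<close>, uniquely of the form \<open>cos_curv k h *\<^sub>R y + sin_curv k h *\<^sub>R n\<close> with \<open>y \<in> L\<close> its
  projection and \<open>h\<close> its signed distance from \<open>L\<close>. In these coordinates the metric is
  \<open>cos_curv\<^sup>2 \<cdot> g\<^sub>L + dh\<^sup>2\<close>, so the volume is \<open>cos_curv k h ^ (d - 1)\<close> times the product of \<open>\<mu>\<^sub>L\<close> and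
  Lebesgue measure, while the section of a ball of radius \<open>R\<close> has a radius \<open>s\<close> with
  \<open>cos_curv k s = cos_curv k R / cos_curv k h\<close>; hence \<open>s > r\<close> iff \<open>\<bar>h\<bar> < alpha k R r\<close>.
  Since the intensity measure of the induced process is already known to be a product, it suffices to
  compare both sides on \<open>A \<times> B\<close> for one \<open>A\<close> of positive finite volume, which can be taken inside
  a single chart and disjoint from the arbitrarily chosen projections of the poles.
\<close>

section \<open>The ambient form\<close>

text \<open>\<open>riemannian_volume\<close> is evaluated only on sets inside the image of one
  parametrization, so all volumes are computed there: in a graph chart \<open>phi\<close> of
  \<open>L\<close> over its tangent space at one point, and in the chart \<open>Phi\<close> that it
  induces on the whole space. Both signs of \<open>k\<close> are handled together by comparing
  cosines after multiplication by \<open>k\<close>, which compensates for the cosine decreasing and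
  the hyperbolic cosine increasing. The formula for the radius of a section is a Pythagorean
  theorem, and this is a linear fact: the normal part of \<open>x\<close> is orthogonal to
  \<open>L\<close>, so \<open>form k x y = lat x * form k (foot x) y\<close> for \<open>y\<close> in
  \<open>L\<close>. The function \<open>alpha\<close> appears because
  \<open>cos R / cos h < cos r\<close> and \<open>cos R / cos r < cos h\<close> are the same
  inequality, so the section radius \<open>r\<close> and the height \<open>h\<close> can trade
  places. On the sphere, a ball with radius above \<open>quarter_length k\<close> that hits
  \<open>L\<close> has a section radius above it as well. Such balls drop out of the first formula,
  but they do count in \<open>N'\<close>; hence the ratio is stated for a radius distribution
  without mass there.\<close>

lemma bounded_bilinear_form: "bounded_bilinear (form k)"
proof -
  have "bilinear (form k :: 'n::finite ambient \<Rightarrow> _)"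
    unfolding bilinear_def
    by (auto intro!: linearI simp: form_def inner_add_left inner_add_right algebra_simps)
  then show ?thesis by (simp add: bilinear_conv_bounded_bilinear)
qed

interpretation form: bounded_bilinear "form k :: 'n::finite ambient \<Rightarrow> _" for k
  by (rule bounded_bilinear_form)

lemma form_commute: "form k x y = form k y x"
  by (simp add: form_def inner_commute mult.commute)

lemmas form_simps = form.add_left form.add_right form.diff_left form.diff_right
  form.scaleR_left form.scaleR_right form.minus_left form.minus_right
  form.sum_left form.sum_right form.zero_left form.zero_right

lemma continuous_on_form [continuous_intros]:
  "continuous_on S f \<Longrightarrow> continuous_on S g \<Longrightarrow> continuous_on S (\<lambda>x. form k (f x) (g x))"
  by (rule form.continuous_on)

lemma borel_measurable_form [measurable]:
  assumes "f \<in> borel_measurable M" "g \<in> borel_measurable M"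
  shows "(\<lambda>x. form k (f x) (g x)) \<in> borel_measurable M"
  using borel_measurable_continuous_Pair[OF assms, of "form k"]
  by (simp add: continuous_on_form continuous_on_fst continuous_on_snd)

lemma form_self_pos:
  assumes "k > 0" "v \<noteq> 0"
  shows "form k v v > 0"
proof -
  have "form k v v = v \<bullet> v" using assms by (simp add: form_def inner_prod_def)
  then show ?thesis using assms by simp
qed

lemma model_spaceD:
  assumes "x \<in> model_space k"
  shows "form k x x = 1 / k" "k < 0 \<Longrightarrow> snd x > 0"
  using assms by (auto simp: model_space_def)

section \<open>Signs of the form on and orthogonal to the model space\<close>

lemma timelike_norm:
  assumes "k < 0" "form k x x = 1 / k"
  shows "norm (fst x) < \<bar>snd x\<bar>"
proof -
  have "(norm (fst x))\<^sup>2 - (snd x)\<^sup>2 = 1 / k"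
    using assms by (simp add: form_def dot_square_norm power2_eq_square)
  moreover have "1 / k < 0" using assms by simp
  ultimately have "(norm (fst x))\<^sup>2 < \<bar>snd x\<bar>\<^sup>2"
    unfolding power2_abs by linarith
  then show ?thesis by (rule power_less_imp_less_base) simp
qed

text \<open>For \<open>k < 0\<close> the vector \<open>p\<close> is timelike, and Cauchy-Schwarz on
  the spatial parts forces everything orthogonal to it to be spacelike. This makes the Minkowski
  form usable like an inner product: normals can be normalized, tangent spaces have orthonormal
  bases, and lengths of orthogonal components are nonnegative.\<close>

lemma form_orthogonal_pos:
  assumes k: "k \<noteq> 0" and p: "form k p p = 1 / k" and o: "form k v p = 0" and v: "v \<noteq> 0"
  shows "form k v v > 0"
proof (cases "k > 0")
  case False
  with k have k: "k < 0" by simp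
  let ?f = "norm (fst v)" and ?g = "norm (fst p)"
  have pp: "?g < \<bar>snd p\<bar>" using timelike_norm[OF k p] .
  have "fst v \<bullet> fst p = snd v * snd p" using o k by (simp add: form_def)
  then have *: "\<bar>snd v\<bar> * \<bar>snd p\<bar> \<le> ?f * ?g"
    by (metis Cauchy_Schwarz_ineq2 abs_mult)
  have sp: "\<bar>snd p\<bar> > 0" using pp norm_ge_zero[of "fst p"] by linarith
  have "?f \<noteq> 0"
  proof
    assume "?f = 0"
    then have "snd v = 0" using * sp by (simp add: mult_le_0_iff)
    with \<open>?f = 0\<close> v show False by (cases v) (auto simp: zero_prod_def)
  qed
  then have "?f * ?g < ?f * \<bar>snd p\<bar>" using pp by simp
  with * have "\<bar>snd v\<bar> * \<bar>snd p\<bar> < ?f * \<bar>snd p\<bar>" by linarith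
  with sp have "\<bar>snd v\<bar> < ?f" by (simp add: mult_less_cancel_right_pos)
  then have "\<bar>snd v\<bar>\<^sup>2 < ?f\<^sup>2" by (intro power_strict_mono) auto
  then show ?thesis using k by (simp add: form_def dot_square_norm power2_eq_square)
next
  case True
  then show ?thesis using v by (rule form_self_pos)
qed

lemma form_orthogonal_nonneg:
  assumes "k \<noteq> 0" "form k p p = 1 / k" "form k v p = 0"
  shows "form k v v \<ge> 0"
  using form_orthogonal_pos[OF assms] by (cases "v = 0") (auto simp: form_simps)

text \<open>The sign of the form tells the two sheets of the hyperboloid apart.\<close>

lemma form_less_0_iff_upper:
  assumes k: "k < 0" and x: "x \<in> model_space k" and z: "form k z z = 1 / k"
  shows "form k z x < 0 \<longleftrightarrow> snd z > 0"
proof -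
  have x': "norm (fst x) < snd x"
    using timelike_norm[OF k model_spaceD(1)[OF x]] model_spaceD(2)[OF x k] by simp
  have z': "norm (fst z) < \<bar>snd z\<bar>" using timelike_norm[OF k z] .
  have "\<bar>fst z \<bullet> fst x\<bar> \<le> norm (fst z) * norm (fst x)" by (rule Cauchy_Schwarz_ineq2)
  also have "\<dots> < \<bar>snd z\<bar> * snd x"
    using x' z' by (intro mult_strict_mono) (auto intro: le_less_trans[OF norm_ge_zero])
  finally have *: "\<bar>fst z \<bullet> fst x\<bar> < \<bar>snd z\<bar> * snd x" .
  have "snd x > 0" using x' norm_ge_zero[of "fst x"] by linarith
  then show ?thesis using * k
    by (cases "snd z > 0") (auto simp: form_def mult_less_0_iff abs_if split: if_splits)
qed

lemma model_spaceI:
  assumes "x \<in> model_space k" "form k z z = 1 / k" "k * form k z x > 0"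
  shows "z \<in> model_space k"
  using assms form_less_0_iff_upper[of k x z]
  by (auto simp: model_space_def zero_less_mult_iff)

text \<open>The range of \<open>k * form k\<close> on the model space.\<close>

definition cos_values :: "real \<Rightarrow> real set" where
  "cos_values k = (if k > 0 then {-1..1} else {1..})"

text \<open>The component \<open>v\<close> of \<open>y\<close> orthogonal to \<open>x\<close> has
  square \<open>(1 - c^2) / k\<close>, which cannot be negative. This bounds \<open>c\<close> for
  \<open>k > 0\<close>; for \<open>k < 0\<close> it leaves two branches, and \<open>c <= -1\<close>
  is excluded because both points lie on the upper sheet.\<close>

lemma form_model_space:
  assumes k: "k \<noteq> 0" and x: "x \<in> model_space k" and y: "y \<in> model_space k"
  shows "k * form k x y \<in> cos_values k"
proof -
  define c where "c = k * form k x y"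
  define v where "v = y - c *\<^sub>R x"
  note [simp] = model_spaceD(1)[OF x] model_spaceD(1)[OF y]
  have "form k v x = 0" using k
    by (simp add: v_def c_def form_simps form_commute[of k y x])
  then have "form k v v \<ge> 0" by (rule form_orthogonal_nonneg[OF k model_spaceD(1)[OF x]])
  moreover have "form k v v = (1 - c\<^sup>2) / k" using k
    by (simp add: v_def form_simps form_commute[of k y x] c_def power2_eq_square field_simps)
  ultimately have nn: "(1 - c\<^sup>2) / k \<ge> 0" by simp
  show ?thesis
  proof (cases "k > 0")
    case True
    with nn have "c\<^sup>2 \<le> 1" by (simp add: zero_le_divide_iff)
    then have "\<bar>c\<bar> \<le> 1" by (simp add: abs_square_le_1)
    with True show ?thesis by (simp add: cos_values_def c_def[symmetric] abs_le_iff)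
  next
    case False
    with k have k': "k < 0" by simp
    with nn have "1 \<le> c\<^sup>2" by (simp add: zero_le_divide_iff)
    moreover have "form k y x < 0"
      using form_less_0_iff_upper[OF k' x, of y] model_spaceD[OF y] k' by simp
    then have "c > 0" using k' by (simp add: c_def form_commute[of k x y] mult_neg_neg)
    ultimately have "c \<ge> 1" by (metis less_imp_le one_power2 power2_le_imp_le)
    with False show ?thesis by (simp add: cos_values_def c_def)
  qed
qed

text \<open>Otherwise \<open>x - y\<close> would be a nonzero vector orthogonal to \<open>x\<close>
  whose square is zero. This equality case gives the uniqueness of the nearest point of
  \<open>L\<close>.\<close>

lemma form_model_space_eq:
  assumes k: "k \<noteq> 0" and x: "x \<in> model_space k" and y: "y \<in> model_space k"
    and e: "k * form k x y = 1"
  shows "x = y"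
proof (rule ccontr)
  assume "x \<noteq> y"
  have xy: "form k x y = 1 / k" using e k by (simp add: field_simps)
  note [simp] = model_spaceD(1)[OF x] model_spaceD(1)[OF y] xy
  have "form k (x - y) (x - y) > 0"
    using \<open>x \<noteq> y\<close> by (intro form_orthogonal_pos[OF k, of x]) (auto simp: form_simps form_commute[of k y x])
  then show False by (simp add: form_simps form_commute[of k y x])
qed

text \<open>Gram-Schmidt with respect to \<open>form k\<close>, which for \<open>k < 0\<close> is
  positive definite only on suitable subspaces \<open>V\<close>.\<close>

lemma form_orthonormal_family:
  fixes V :: "'n::finite ambient set"
  assumes V: "subspace V" and pos: "\<And>v. v \<in> V \<Longrightarrow> v \<noteq> 0 \<Longrightarrow> form k v v > 0" and "j \<le> dim V"
  shows "\<exists>b. \<forall>i<j. b i \<in> V \<and> (\<forall>i'<j. form k (b i) (b i') = (if i = i' then 1 else 0))"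
  using \<open>j \<le> dim V\<close>
proof (induction j)
  case (Suc j)
  then obtain b where b: "\<And>i. i < j \<Longrightarrow> b i \<in> V"
    "\<And>i i'. i < j \<Longrightarrow> i' < j \<Longrightarrow> form k (b i) (b i') = (if i = i' then 1 else 0)" by auto
  have "dim (b ` {..<j}) \<le> card (b ` {..<j})" by (rule dim_le_card') simp
  also have "\<dots> \<le> j" using card_image_le[of "{..<j}" b] by simp
  finally have "dim (span (b ` {..<j})) < dim V" using Suc.prems by simp
  then obtain v where v: "v \<in> V" "v \<notin> span (b ` {..<j})"
    by (metis dim_subset not_less subsetI)
  define w where "w = v - (\<Sum>i<j. form k v (b i) *\<^sub>R b i)"
  have "w \<in> V" unfolding w_def
    using V v b by (intro subspace_diff subspace_sum subspace_scale) auto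
  have wb: "form k w (b i) = 0" if "i < j" for i
    using that by (simp add: w_def form_simps b(2) if_distrib[of "\<lambda>x. _ * x"] sum.delta cong: if_cong)
  have "w \<noteq> 0"
  proof
    assume "w = 0"
    then have "v = (\<Sum>i<j. form k v (b i) *\<^sub>R b i)" by (simp add: w_def)
    also have "\<dots> \<in> span (b ` {..<j})" by (intro span_sum span_scale span_base) auto
    finally show False using v by simp
  qed
  then have ww: "form k w w > 0" using pos \<open>w \<in> V\<close> by simp
  define b' where "b' = b(j := (1 / sqrt (form k w w)) *\<^sub>R w)"
  have "b' i \<in> V \<and> form k (b' i) (b' i') = (if i = i' then 1 else 0)"
    if "i < Suc j" "i' < Suc j" for i i'
  proof -
    have "form k (b i) w = 0" if "i < j" for i using wb[OF that] by (simp add: form_commute)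
    moreover have "form k ((1 / sqrt (form k w w)) *\<^sub>R w) ((1 / sqrt (form k w w)) *\<^sub>R w) = 1"
      using ww by (simp add: form_simps)
    moreover have "(1 / sqrt (form k w w)) *\<^sub>R w \<in> V"
      using \<open>w \<in> V\<close> V by (rule subspace_scale[rotated])
    ultimately show ?thesis
      using b wb that by (cases "i = j"; cases "i' = j") (simp_all add: b'_def form.scaleR_left form.scaleR_right)
  qed
  then show ?case by blast
qed simp

lemma form_orthonormal_basis:
  fixes V :: "'n::finite ambient set"
  assumes V: "subspace V" and pos: "\<And>v. v \<in> V \<Longrightarrow> v \<noteq> 0 \<Longrightarrow> form k v v > 0"
    and dim: "dim V = CARD('m::finite)"
  obtains b :: "'m::finite \<Rightarrow> 'n ambient" where
    "\<And>i. b i \<in> V" "\<And>i j. form k (b i) (b j) = (if i = j then 1 else 0)"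
    "\<And>v. v \<in> V \<Longrightarrow> (\<Sum>i\<in>UNIV. form k v (b i) *\<^sub>R b i) = v"
proof -
  obtain b0 :: "nat \<Rightarrow> 'n ambient" where b0: "\<And>i. i < CARD('m) \<Longrightarrow> b0 i \<in> V"
    "\<And>i i'. i < CARD('m) \<Longrightarrow> i' < CARD('m) \<Longrightarrow> form k (b0 i) (b0 i') = (if i = i' then 1 else 0)"
    using form_orthonormal_family[OF V pos, of "CARD('m)"] dim by auto
  obtain e :: "'m \<Rightarrow> nat" where e: "bij_betw e UNIV {0..<CARD('m)}"
    using ex_bij_betw_finite_nat[of "UNIV :: 'm set"] by auto
  define b where "b = b0 \<circ> e"
  have lt: "e i < CARD('m)" for i using e by (auto simp: bij_betw_def)
  have inj: "e i = e j \<longleftrightarrow> i = j" for i j using e by (auto simp: bij_betw_def inj_on_def)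
  have bV: "b i \<in> V" for i by (simp add: b_def b0 lt)
  have on: "form k (b i) (b j) = (if i = j then 1 else 0)" for i j
    by (simp add: b_def b0 lt inj)
  define \<iota> :: "real ^ 'm \<Rightarrow> 'n ambient" where "\<iota> u = (\<Sum>i\<in>UNIV. (u $ i) *\<^sub>R b i)" for u
  have lin: "linear \<iota>"
    by (rule linearI) (simp_all add: \<iota>_def scaleR_add_left sum.distrib scaleR_sum_right)
  have coord: "form k (\<iota> u) (b j) = u $ j" for u j
    by (simp add: \<iota>_def form_simps on if_distrib[of "\<lambda>x. _ * x"] sum.delta cong: if_cong)
  have "inj \<iota>" by (rule injI) (metis coord vec_eq_iff)
  have "range \<iota> = V"
  proof (rule subspace_dim_equal)
    show "subspace (range \<iota>)" by (rule linear_subspace_image[OF lin]) simp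
    show "range \<iota> \<subseteq> V" unfolding \<iota>_def using V bV by (auto intro!: subspace_sum subspace_scale)
    show "dim V \<le> dim (range \<iota>)"
      using dim_image_eq[OF lin, of UNIV] \<open>inj \<iota>\<close> dim by (simp add: inj_on_subset)
  qed (rule V)
  have "(\<Sum>i\<in>UNIV. form k v (b i) *\<^sub>R b i) = v" if vV: "v \<in> V" for v
  proof -
    obtain u where u: "v = \<iota> u" using vV \<open>range \<iota> = V\<close> by auto
    show ?thesis by (simp only: u coord) (simp only: \<iota>_def)
  qed
  with that[of b] bV on show ?thesis by blast
qed

text \<open>A Euclidean normal \<open>z\<close> of the linear hyperplane becomes a normal for
  \<open>form k\<close> when its last coordinate is multiplied by \<open>sgn k\<close>. It is
  orthogonal to a point of the nonempty set \<open>L\<close>, so its square is positive and it can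
  be normalized.\<close>

lemma hypersurface_normal:
  fixes L :: "'n::finite ambient set"
  assumes k: "k \<noteq> 0" and L: "totally_geodesic_hypersurface k L"
  obtains n where "form k n n = 1" "L = {x \<in> model_space k. form k x n = 0}"
proof -
  obtain W where W: "subspace W" "dim W = CARD('n)" "L = model_space k \<inter> W" "L \<noteq> {}"
    using L by (auto simp: totally_geodesic_hypersurface_def)
  obtain p where p: "p \<in> model_space k" "p \<in> W" using W by auto
  have D: "DIM('n ambient) = CARD('n) + 1" by simp
  obtain z :: "'n ambient" where z: "z \<noteq> 0" "span W \<subseteq> {x. z \<bullet> x = 0}"
    using lowdim_subset_hyperplane[of W] W D by auto
  have Wz: "W = {x. z \<bullet> x = 0}"
  proof (rule subspace_dim_equal)
    show "subspace {x. z \<bullet> x = 0}" by (rule subspace_hyperplane)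
    show "W \<subseteq> {x. z \<bullet> x = 0}" using z span_superset by blast
    show "dim {x. z \<bullet> x = 0} \<le> dim W" using dim_hyperplane[OF z(1)] W D by simp
  qed (rule W)
  define n0 where "n0 = (fst z, sgn k * snd z)"
  have n0: "form k x n0 = z \<bullet> x" for x
    using k by (simp add: form_def n0_def inner_prod_def inner_commute sgn_if)
  have "n0 \<noteq> 0" using z k by (auto simp: n0_def zero_prod_def prod_eq_iff sgn_if)
  have "form k n0 n0 > 0"
    using form_orthogonal_pos[OF k model_spaceD(1)[OF p(1)], of n0] \<open>n0 \<noteq> 0\<close> p(2) n0[of p]
    by (simp add: Wz form_commute[of k n0 p])
  then have "form k ((1 / sqrt (form k n0 n0)) *\<^sub>R n0) ((1 / sqrt (form k n0 n0)) *\<^sub>R n0) = 1"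
    by (simp add: form_simps)
  moreover have "L = {x \<in> model_space k. form k x ((1 / sqrt (form k n0 n0)) *\<^sub>R n0) = 0}"
    using \<open>form k n0 n0 > 0\<close> by (auto simp: W(3) Wz form_simps n0)
  ultimately show ?thesis by (rule that)
qed

section \<open>Trigonometry of constant curvature\<close>

definition sin_curv :: "real \<Rightarrow> real \<Rightarrow> real" where
  "sin_curv k h = (if k > 0 then sin (sqrt k * h) / sqrt k else sinh (sqrt (- k) * h) / sqrt (- k))"

definition arccos_curv :: "real \<Rightarrow> real \<Rightarrow> real" where
  "arccos_curv k c = (if k > 0 then arccos c / sqrt k else arcosh c / sqrt (- k))"

text \<open>The candidate distances: on this set \<open>cos_curv k\<close> is injective, with
  inverse \<open>arccos_curv k\<close>.\<close>

definition half_circle :: "real \<Rightarrow> real set" where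
  "half_circle k = {t. 0 \<le> t \<and> (k > 0 \<longrightarrow> sqrt k * t \<le> pi)}"

lemma cos_sin_curv: "k \<noteq> 0 \<Longrightarrow> (cos_curv k h)\<^sup>2 + k * (sin_curv k h)\<^sup>2 = 1"
  by (auto simp: cos_curv_def sin_curv_def power_divide cosh_square_eq)

lemma DERIV_cos_curv [derivative_intros]:
  assumes "k \<noteq> 0"
  shows "(cos_curv k has_real_derivative - k * sin_curv k h) (at h within S)"
proof (cases "k > 0")
  case False
  with assms have *: "sqrt (- k) * (sqrt (- k) * y) = - (k * y)" for y by (simp flip: mult.assoc)
  show ?thesis using assms False unfolding cos_curv_def[abs_def] sin_curv_def
    by (auto intro!: derivative_eq_intros simp: field_simps *)
qed (auto intro!: derivative_eq_intros simp: cos_curv_def[abs_def] sin_curv_def field_simps)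

lemma DERIV_sin_curv [derivative_intros]:
  assumes "k \<noteq> 0"
  shows "(sin_curv k has_real_derivative cos_curv k h) (at h within S)"
  using assms unfolding cos_curv_def sin_curv_def[abs_def] divide_inverse
  by (cases "k > 0") (auto intro!: derivative_eq_intros)

lemma continuous_on_cos_curv [continuous_intros]:
  fixes f :: "'a::t2_space \<Rightarrow> real"
  shows "continuous_on S f \<Longrightarrow> continuous_on S (\<lambda>x. cos_curv k (f x))"
  unfolding cos_curv_def
  by (cases "k > 0") (auto intro!: continuous_on_cos continuous_on_cosh continuous_on_mult continuous_on_const)

lemma continuous_on_sin_curv [continuous_intros]:
  fixes f :: "'a::t2_space \<Rightarrow> real"
  shows "continuous_on S f \<Longrightarrow> continuous_on S (\<lambda>x. sin_curv k (f x))"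
  unfolding sin_curv_def divide_inverse
  by (cases "k > 0") (auto intro!: continuous_on_sin continuous_on_sinh continuous_on_mult continuous_on_const)

lemma cos_curv_0 [simp]: "cos_curv k 0 = 1" and sin_curv_0 [simp]: "sin_curv k 0 = 0"
  by (simp_all add: cos_curv_def sin_curv_def)

lemma cos_curv_abs [simp]: "cos_curv k \<bar>h\<bar> = cos_curv k h"
  by (simp add: cos_curv_def abs_if)

lemma geodesic_dist_arccos_curv: "geodesic_dist k x y = arccos_curv k (k * form k x y)"
  by (simp add: geodesic_dist_def arccos_curv_def)

lemma cos_curv_values: "cos_curv k t \<in> cos_values k"
  by (simp add: cos_curv_def cos_values_def cosh_real_ge_1)

lemma one_cos_values [simp]: "1 \<in> cos_values k"
  by (simp add: cos_values_def)

lemma cos_values_le: "c \<in> cos_values k \<Longrightarrow> k * c \<le> k * 1"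
  using mult_left_mono_neg[of 1 c k]
  by (cases "k = 0") (auto simp: cos_values_def mult_left_mono[of c 1 k, simplified] split: if_splits)

lemma cos_values_eq_1: "k \<noteq> 0 \<Longrightarrow> c \<in> cos_values k \<Longrightarrow> k * 1 \<le> k * c \<Longrightarrow> c = 1"
  by (auto simp: cos_values_def mult_le_cancel_left split: if_splits)

text \<open>\<open>arccos\<close> is decreasing and \<open>arcosh\<close> is increasing, while the
  factor \<open>k\<close> reverses the order exactly in the second case. One statement thus serves
  both geometries.\<close>

lemma arccos_curv_le_iff:
  assumes "k \<noteq> 0" "c \<in> cos_values k" "c' \<in> cos_values k"
  shows "arccos_curv k c \<le> arccos_curv k c' \<longleftrightarrow> k * c' \<le> k * c"
proof (cases "k > 0")
  case True
  then show ?thesis using assms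
    by (simp add: arccos_curv_def cos_values_def divide_le_cancel arccos_le_mono abs_le_iff)
next
  case False
  then have "k < 0" using assms by simp
  then show ?thesis using assms arcosh_less_iff_real[of c' c]
    by (simp add: arccos_curv_def cos_values_def divide_less_cancel not_less[symmetric]
        del: arcosh_less_iff_real)
qed

lemma arccos_curv_1 [simp]: "arccos_curv k 1 = 0"
  by (simp add: arccos_curv_def)

lemma arccos_curv_half_circle:
  assumes "k \<noteq> 0" "c \<in> cos_values k"
  shows "arccos_curv k c \<in> half_circle k"
  using assms arccos_lbound[of c] arccos_ubound[of c]
  by (auto simp: arccos_curv_def half_circle_def cos_values_def)

lemma arccos_curv_nonneg:
  assumes "k \<noteq> 0" "c \<in> cos_values k"
  shows "arccos_curv k c \<ge> 0"
  using arccos_curv_half_circle[OF assms] by (simp add: half_circle_def)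

lemma arccos_curv_cos_curv:
  assumes "k \<noteq> 0" "t \<in> half_circle k"
  shows "arccos_curv k (cos_curv k t) = t"
  using assms by (auto simp: arccos_curv_def cos_curv_def half_circle_def arccos_cos arcosh_cosh_real)

lemma cos_curv_arccos_curv:
  assumes "k \<noteq> 0" "c \<in> cos_values k"
  shows "cos_curv k (arccos_curv k c) = c"
  using assms by (auto simp: arccos_curv_def cos_curv_def cos_values_def)

lemma cos_curv_le_iff:
  assumes "k \<noteq> 0" "s \<in> half_circle k" "t \<in> half_circle k"
  shows "k * cos_curv k t \<le> k * cos_curv k s \<longleftrightarrow> s \<le> t"
  using arccos_curv_le_iff[OF assms(1) cos_curv_values cos_curv_values, of s t]
  by (simp add: arccos_curv_cos_curv assms)

text \<open>The radius of the section with \<open>L\<close> of a ball of radius \<open>R\<close> whose centre has distance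
  \<open>arccos_curv k c\<close> from \<open>L\<close>. On the sphere, the truncations account for balls that contain \<open>L\<close>.\<close>

definition section_length :: "real \<Rightarrow> real \<Rightarrow> real \<Rightarrow> real" where
  "section_length k c R = arccos_curv k
     (if k > 0 then max (-1) (cos (min (sqrt k * R) pi) / c) else cosh (sqrt (- k) * R) / c)"

text \<open>A ball that reaches \<open>L\<close> has radius at least the distance of its centre from
  \<open>L\<close>. Comparing the cosines of these two lengths and dividing by \<open>c\<close>
  keeps the quotient on the correct side of 1; on the sphere the truncation at -1 takes care of the
  other side.\<close>

lemma section_length_argument:
  assumes "k \<noteq> 0" "c > 0" "c \<in> cos_values k" "arccos_curv k c \<le> R"
  shows "(if k > 0 then max (-1) (cos (min (sqrt k * R) pi) / c) else cosh (sqrt (- k) * R) / c)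
    \<in> cos_values k"
proof (cases "k > 0")
  case True
  with assms have c: "0 < c" "c \<le> 1" and ac: "arccos c \<le> sqrt k * R"
    by (auto simp: cos_values_def arccos_curv_def field_simps)
  have "cos (min (sqrt k * R) pi) \<le> c"
  proof -
    have "arccos c \<le> min (sqrt k * R) pi" using ac c arccos_ubound[of c] by simp
    then have "cos (min (sqrt k * R) pi) \<le> cos (arccos c)"
      using c arccos_lbound[of c] by (intro cos_monotone_0_pi_le) auto
    then show ?thesis using c by simp
  qed
  then show ?thesis using True c by (simp add: cos_values_def)
next
  case False
  with assms have k: "k < 0" and c: "c \<ge> 1" and ac: "arcosh c \<le> sqrt (- k) * R"
    by (auto simp: cos_values_def arccos_curv_def field_simps)
  have "cosh (arcosh c) \<le> cosh (sqrt (- k) * R)"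
    using ac c by (subst cosh_real_nonneg_le_iff) (auto intro: order_trans[OF arcosh_nonneg_real])
  then show ?thesis using k c by (simp add: cos_values_def field_simps)
qed

lemma section_length_half_circle:
  assumes "k \<noteq> 0" "c > 0" "c \<in> cos_values k" "arccos_curv k c \<le> R"
  shows "section_length k c R \<in> half_circle k"
  unfolding section_length_def
  by (rule arccos_curv_half_circle[OF assms(1) section_length_argument[OF assms]])

lemma mult_cos_values:
  assumes "c > 0" "c \<in> cos_values k" "c' \<in> cos_values k"
  shows "c * c' \<in> cos_values k"
proof (cases "k > 0")
  case True
  then have "\<bar>c * c'\<bar> \<le> 1"
    using assms by (auto simp: cos_values_def abs_mult intro!: mult_le_one)
  with True show ?thesis by (simp add: cos_values_def abs_le_iff)
next
  case False
  then show ?thesis using assms mult_mono[of 1 c 1 c'] by (auto simp: cos_values_def)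
qed

text \<open>By the Pythagorean theorem, a point of \<open>L\<close> at distance \<open>t\<close>
  from the foot of the centre has distance \<open>arccos_curv k (c * cos_curv k t)\<close> from the
  centre. The left side therefore says that this point lies in the ball, and the equivalence solves
  the condition for \<open>t\<close>.\<close>

lemma le_section_length_iff:
  assumes k: "k \<noteq> 0" and c: "c > 0" "c \<in> cos_values k" "arccos_curv k c \<le> R"
    and t: "t \<in> half_circle k"
  shows "arccos_curv k (c * cos_curv k t) \<le> R \<longleftrightarrow> t \<le> section_length k c R"
proof -
  note arg = section_length_argument[OF k c]
  have R: "R \<ge> 0" using arccos_curv_nonneg[OF k c(2)] c by simp
  have "t \<le> section_length k c R \<longleftrightarrow>
    arccos_curv k (cos_curv k t) \<le> section_length k c R"
    by (simp add: arccos_curv_cos_curv k t)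
  also have "\<dots> \<longleftrightarrow> arccos_curv k (c * cos_curv k t) \<le> R"
  proof (cases "k > 0")
    case True
    have c1: "c \<le> 1" using c True by (simp add: cos_values_def)
    let ?m = "min (sqrt k * R) pi"
    have v: "c * cos_curv k t \<in> cos_values k" by (intro mult_cos_values c cos_curv_values)
    have "?m \<ge> 0" using R True by simp
    have "arccos_curv k (cos_curv k t) \<le> section_length k c R \<longleftrightarrow>
      max (-1) (cos ?m / c) \<le> cos_curv k t"
      using arg True unfolding section_length_def
      by (subst arccos_curv_le_iff[OF k cos_curv_values]) auto
    also have "\<dots> \<longleftrightarrow> cos ?m / c \<le> cos_curv k t"
      using True by (simp add: cos_curv_def)
    also have "\<dots> \<longleftrightarrow> cos ?m \<le> c * cos_curv k t"
      using c by (simp add: field_simps)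
    also have "\<dots> \<longleftrightarrow> arccos (c * cos_curv k t) \<le> arccos (cos ?m)"
      using v True by (subst arccos_le_mono) (auto simp: cos_values_def abs_le_iff)
    also have "arccos (cos ?m) = ?m" using \<open>?m \<ge> 0\<close> by (intro arccos_cos) auto
    \<comment> \<open>An \<open>arccos\<close> never exceeds \<open>pi\<close>, so cutting the
      radius off at \<open>pi\<close> does not change the comparison.\<close>
    also have "arccos (c * cos_curv k t) \<le> ?m \<longleftrightarrow> arccos (c * cos_curv k t) \<le> sqrt k * R"
      using arccos_ubound[of "c * cos_curv k t"] v True by (auto simp: cos_values_def)
    also have "\<dots> \<longleftrightarrow> arccos_curv k (c * cos_curv k t) \<le> R"
      using True by (simp add: arccos_curv_def field_simps)
    finally show ?thesis .
  next
    case False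
    with k have k': "k < 0" by simp
    have v: "c * cos_curv k t \<in> cos_values k" by (intro mult_cos_values c cos_curv_values)
    have RR: "R = arccos_curv k (cos_curv k R)"
      using R k' by (subst arccos_curv_cos_curv) (auto simp: half_circle_def)
    have "arccos_curv k (cos_curv k t) \<le> section_length k c R \<longleftrightarrow>
      cos_curv k t \<le> cosh (sqrt (- k) * R) / c"
      using arg k' unfolding section_length_def
      by (subst arccos_curv_le_iff[OF k cos_curv_values])
        (auto simp: mult_le_cancel_left simp del: times_divide_eq_right)
    also have "\<dots> \<longleftrightarrow> c * cos_curv k t \<le> cos_curv k R"
      using c k' by (simp add: field_simps cos_curv_def)
    also have "\<dots> \<longleftrightarrow> arccos_curv k (c * cos_curv k t) \<le> arccos_curv k (cos_curv k R)"
      using k' by (subst arccos_curv_le_iff[OF k v cos_curv_values]) auto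
    finally show ?thesis using RR by simp
  qed
  finally show ?thesis ..
qed


section \<open>Projection onto a hypersurface\<close>

locale geodesic_hypersurface =
  fixes k :: real and n :: "'n::finite ambient" and L :: "'n ambient set"
  assumes k: "k \<noteq> 0" and nn: "form k n n = 1" and dim_ge_2: "CARD('n) \<ge> 2"
    and L_def: "L = {x \<in> model_space k. form k x n = 0}" and L_nonempty: "L \<noteq> {}"
begin

definition height :: "'n ambient \<Rightarrow> real" where
  "height x = form k x n"

text \<open>The number \<open>lat x\<close> is \<open>cos_curv k h\<close> for \<open>h\<close> the distance of \<open>x\<close> from \<open>L\<close>; it vanishes at the
  poles of \<open>L\<close>, which exist for \<open>k > 0\<close> only.\<close>

definition lat :: "'n ambient \<Rightarrow> real" where
  "lat x = sqrt (1 - k * (height x)\<^sup>2)"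

definition foot :: "'n ambient \<Rightarrow> 'n ambient" where
  "foot x = (1 / lat x) *\<^sub>R (x - height x *\<^sub>R n)"

lemma L_model: "y \<in> L \<Longrightarrow> y \<in> model_space k" and L_normal: "y \<in> L \<Longrightarrow> form k y n = 0"
  "y \<in> L \<Longrightarrow> form k n y = 0"
  by (auto simp: L_def form_commute)

lemma form_horizontal:
  assumes "x \<in> model_space k"
  shows "form k (x - height x *\<^sub>R n) (x - height x *\<^sub>R n) = (1 - k * (height x)\<^sup>2) / k"
  using k nn model_spaceD(1)[OF assms]
  by (simp add: form_simps form_commute[of k n x] height_def power2_eq_square field_simps)

lemma lat_arg_nonneg:
  assumes "x \<in> model_space k"
  shows "1 - k * (height x)\<^sup>2 \<ge> 0"
proof (cases "k > 0")
  case True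
  have "form k (x - height x *\<^sub>R n) (x - height x *\<^sub>R n) \<ge> 0"
    using form_self_pos[OF True, of "x - height x *\<^sub>R n"]
    by (cases "x - height x *\<^sub>R n = 0") (auto simp: form.zero_left intro: less_imp_le)
  then show ?thesis using form_horizontal[OF assms] True by (simp add: zero_le_divide_iff)
next
  case False
  then have "k * (height x)\<^sup>2 \<le> 0" by (simp add: mult_nonpos_nonneg)
  then show ?thesis by simp
qed

lemma lat_square: "x \<in> model_space k \<Longrightarrow> (lat x)\<^sup>2 = 1 - k * (height x)\<^sup>2"
  using lat_arg_nonneg by (simp add: lat_def)

lemma lat_nonneg: "x \<in> model_space k \<Longrightarrow> lat x \<ge> 0"
  using lat_arg_nonneg by (simp add: lat_def)

lemma lat_values: "x \<in> model_space k \<Longrightarrow> lat x \<in> cos_values k"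
  using lat_nonneg[of x] k order_trans[of "-1" 0 "lat x"]
  by (auto simp: cos_values_def lat_def mult_nonpos_nonneg)

lemma foot_in_L:
  assumes x: "x \<in> model_space k" and l: "lat x > 0"
  shows "foot x \<in> L"
proof -
  have xn: "form k n x = height x" by (simp add: height_def form_commute)
  have ff: "form k (foot x) (foot x) = 1 / k"
    unfolding foot_def form.scaleR_left form.scaleR_right form_horizontal[OF x] lat_square[OF x, symmetric]
    using l by (simp add: power2_eq_square)
  have "k * form k (foot x) x = (lat x)\<^sup>2 / lat x"
    using k l unfolding foot_def lat_square[OF x]
    by (simp add: form_simps model_spaceD[OF x] xn field_simps power2_eq_square)
  also have "\<dots> > 0" using l by simp
  finally have "foot x \<in> model_space k" by (intro model_spaceI[OF x ff])
  moreover have "form k (foot x) n = 0"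
    by (simp add: foot_def form_simps nn) (simp add: height_def)
  ultimately show ?thesis by (simp add: L_def)
qed

text \<open>The discarded normal component is orthogonal to every point of \<open>L\<close>. Read in
  terms of distances, this is the Pythagorean theorem for the right triangle with vertices
  \<open>x\<close>, \<open>foot x\<close> and \<open>y\<close>.\<close>

lemma form_foot:
  assumes "y \<in> L" "lat x > 0"
  shows "form k x y = lat x * form k (foot x) y"
  using assms by (simp add: foot_def form_simps L_normal)

text \<open>A vanishing \<open>lat x\<close> means \<open>k * (height x)^2 = 1\<close>, which forces
  \<open>k > 0\<close>. The form is then definite, and the horizontal part of \<open>x\<close>,
  having square zero, vanishes.\<close>

lemma pole_eq:
  assumes x: "x \<in> model_space k" and l: "lat x = 0"
  shows "k > 0" "x = height x *\<^sub>R n" "(height x)\<^sup>2 = 1 / k"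
proof -
  have e: "1 - k * (height x)\<^sup>2 = 0" using lat_square[OF x] l by simp
  show kp: "k > 0"
  proof (rule ccontr)
    assume "\<not> k > 0"
    then have "k * (height x)\<^sup>2 \<le> 0" by (simp add: mult_nonpos_nonneg)
    with e show False by simp
  qed
  show "x = height x *\<^sub>R n"
    using form_horizontal[OF x] form_self_pos[OF kp, of "x - height x *\<^sub>R n"] e by auto
  show "(height x)\<^sup>2 = 1 / k" using e k by (simp add: field_simps)
qed

text \<open>Away from the poles, the distance to \<open>y\<close> in \<open>L\<close> is a strictly
  monotone function of the distance from \<open>foot x\<close> to \<open>y\<close>, so
  \<open>foot x\<close> is the only minimizer. At a pole all points of \<open>L\<close> are equally
  far away, so every one of them is a minimizer and the choice at least lands in
  \<open>L\<close>.\<close>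

lemma arg_min_on_L:
  assumes x: "x \<in> model_space k"
  shows "orth_proj k L x \<in> L" "lat x > 0 \<Longrightarrow> orth_proj k L x = foot x"
proof -
  let ?m = "is_arg_min (geodesic_dist k x) (\<lambda>y. y \<in> L)"
  have op: "orth_proj k L x = (SOME y. ?m y)"
    by (simp add: orth_proj_def arg_min_on_def arg_min_def)
  have "(\<exists>y. ?m y) \<and> (lat x > 0 \<longrightarrow> (\<forall>y. ?m y \<longrightarrow> y = foot x))"
  proof (cases "lat x > 0")
    case True
    have f: "foot x \<in> L" by (rule foot_in_L[OF x True])
    have dist: "geodesic_dist k x y = arccos_curv k (lat x * (k * form k (foot x) y))" if "y \<in> L" for y
      by (simp add: geodesic_dist_arccos_curv form_foot[OF that True] mult_ac)
    have ff: "k * form k (foot x) (foot x) = 1"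
      using model_spaceD(1)[OF L_model[OF f]] k by simp
    have val: "k * form k (foot x) y \<in> cos_values k" if "y \<in> L" for y
      by (rule form_model_space[OF k L_model[OF f] L_model[OF that]])
    have le: "geodesic_dist k x (foot x) \<le> geodesic_dist k x y" if y: "y \<in> L" for y
    proof -
      have "k * (k * form k (foot x) y) \<le> k * 1"
        by (rule cos_values_le[OF val[OF y]])
      then have "lat x * (k * (k * form k (foot x) y)) \<le> lat x * (k * 1)"
        using True by (rule mult_left_mono[OF _ less_imp_le])
      then have "k * (lat x * (k * form k (foot x) y)) \<le> k * (lat x * 1)"
        by (simp only: mult.left_commute[of k "lat x"])
      then show ?thesis
        unfolding dist[OF y] dist[OF f] ff
        by (subst arccos_curv_le_iff[OF k])
           (assumption | rule mult_cos_values True lat_values x val y one_cos_values)+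
    qed
    have "y = foot x" if m: "?m y" for y
    proof -
      have y: "y \<in> L" using m by (simp add: is_arg_min_def)
      have "geodesic_dist k x y \<le> geodesic_dist k x (foot x)"
        using m f unfolding is_arg_min_def by (meson not_less)
      then have "k * (lat x * 1) \<le> k * (lat x * (k * form k (foot x) y))"
        unfolding dist[OF y] dist[OF f] ff
        using arccos_curv_le_iff[OF k mult_cos_values mult_cos_values,
            OF True lat_values[OF x] val[OF y] True lat_values[OF x] one_cos_values] by simp
      then have "lat x * (k * 1) \<le> lat x * (k * (k * form k (foot x) y))"
        by (simp only: mult.left_commute[of k "lat x"])
      then have "k * 1 \<le> k * (k * form k (foot x) y)"
        using True by (simp only: mult_le_cancel_left_pos)
      then have "k * form k (foot x) y = 1"
        by (rule cos_values_eq_1[OF k val[OF y]])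
      then show "y = foot x"
        using form_model_space_eq[OF k L_model[OF f] L_model[OF y]] by simp
    qed
    moreover have "?m (foot x)" using f le by (auto simp: is_arg_min_def not_less)
    ultimately show ?thesis by blast
  next
    case False
    then have l: "lat x = 0" using lat_nonneg[OF x] by simp
    have "form k x y = 0" if "y \<in> L" for y
      by (subst pole_eq(2)[OF x l]) (simp add: form_simps L_normal that)
    then have "?m y" if "y \<in> L" for y
      using that by (auto simp: is_arg_min_def geodesic_dist_def)
    then show ?thesis using False L_nonempty by auto
  qed
  then show "orth_proj k L x \<in> L" "lat x > 0 \<Longrightarrow> orth_proj k L x = foot x"
    unfolding op by (metis (mono_tags, lifting) is_arg_min_def someI_ex)+
qed

lemma form_orth_proj:
  assumes x: "x \<in> model_space k" and y: "y \<in> L"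
  shows "k * form k x y = lat x * (k * form k (orth_proj k L x) y)"
proof (cases "lat x = 0")
  case True
  have "form k x y = 0"
    by (subst pole_eq(2)[OF x True]) (simp add: form_simps L_normal y)
  then show ?thesis using True by simp
next
  case False
  then have "lat x > 0" using lat_nonneg[OF x] by simp
  then show ?thesis using arg_min_on_L(2)[OF x] form_foot[OF y] by simp
qed

text \<open>The hyperplane orthogonal to \<open>n\<close> has dimension \<open>d >= 2\<close>, so it
  is not exhausted by the line through \<open>p\<close>; this is where \<open>d >= 2\<close> enters.
  Subtracting the \<open>p\<close> component from a vector off that line gives a tangent vector of
  positive square.\<close>

lemma unit_tangent:
  assumes p: "p \<in> L"
  obtains v where "form k v n = 0" "form k v p = 0" "form k v v = 1"
proof -
  define n' where "n' = (fst n, sgn k * snd n)"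
  have fn: "form k v n = n' \<bullet> v" for v
    by (simp add: form_def n'_def inner_prod_def inner_commute)
  have "n' \<noteq> 0" using nn fn[of n] by auto
  then have "dim {v. form k v n = 0} = CARD('n)"
    using dim_hyperplane[of n'] by (simp add: fn)
  moreover have "dim (span {p}) \<le> 1" using dim_le_card'[of "{p}"] by simp
  ultimately obtain w where w: "form k w n = 0" "w \<notin> span {p}"
    using dim_subset[of "{v. form k v n = 0}" "span {p}"] dim_ge_2 by fastforce
  define u where "u = w - (k * form k w p) *\<^sub>R p"
  have "u \<noteq> 0" using w by (auto simp: u_def span_singleton)
  have up: "form k u p = 0" using k model_spaceD(1)[OF L_model[OF p]]
    by (simp add: u_def form_simps)
  have "form k u u > 0"
    by (rule form_orthogonal_pos[OF k model_spaceD(1)[OF L_model[OF p]] up \<open>u \<noteq> 0\<close>])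
  then show ?thesis
    using up w by (intro that[of "(1 / sqrt (form k u u)) *\<^sub>R u"])
      (simp_all add: form.scaleR_left form.scaleR_right, simp add: u_def form_simps L_normal p)
qed

text \<open>The witness is the point at parameter \<open>t\<close> on the geodesic that leaves
  \<open>p\<close> in a unit tangent direction of \<open>L\<close>. Points at prescribed distances
  are needed to show that no smaller radius describes the same section.\<close>

lemma geodesic_in_L:
  assumes p: "p \<in> L"
  obtains y where "y \<in> L" "k * form k p y = cos_curv k t"
proof -
  obtain v where v: "form k v n = 0" "form k v p = 0" "form k v v = 1"
    by (rule unit_tangent[OF p])
  define y where "y = cos_curv k t *\<^sub>R p + sin_curv k t *\<^sub>R v"
  note pp = model_spaceD(1)[OF L_model[OF p]]
  have py: "k * form k p y = cos_curv k t" and yn: "form k y n = 0"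
    using k v by (simp_all add: y_def form_simps pp form_commute[of k p v] L_normal p)
  have "form k y y = ((cos_curv k t)\<^sup>2 + k * (sin_curv k t)\<^sup>2) / k"
    using k v by (simp add: y_def form_simps pp form_commute[of k p v] power2_eq_square field_simps)
  then have yy: "form k y y = 1 / k" by (simp add: cos_sin_curv k)
  have "y \<in> model_space k"
  proof (cases "k > 0")
    case True
    then show ?thesis using yy by (simp add: model_space_def)
  next
    case False
    then have "k * form k y p > 0"
      using cos_curv_values[of k t] py by (simp add: cos_values_def form_commute[of k y p])
    then show ?thesis by (rule model_spaceI[OF L_model[OF p] yy])
  qed
  then show ?thesis using py yn by (intro that[of y]) (simp_all add: L_def)
qed

text \<open>The distance from \<open>x\<close> to \<open>L\<close> is attained at
  \<open>orth_proj k L x\<close>, where the second factor in \<open>form_orth_proj\<close> becomes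
  1. The argument includes the poles.\<close>

lemma ball_meets_L_iff:
  assumes x: "x \<in> model_space k"
  shows "geodesic_ball k x R \<inter> L \<noteq> {} \<longleftrightarrow> arccos_curv k (lat x) \<le> R"
proof -
  let ?q = "orth_proj k L x"
  have q: "?q \<in> L" by (rule arg_min_on_L(1)[OF x])
  have dist: "geodesic_dist k x y = arccos_curv k (lat x * (k * form k ?q y))" if "y \<in> L" for y
    by (simp add: geodesic_dist_arccos_curv form_orth_proj[OF x that])
  have qq: "k * form k ?q ?q = 1"
    using model_spaceD(1)[OF L_model[OF q]] k by simp
  have min: "geodesic_dist k x ?q \<le> geodesic_dist k x y" if "y \<in> L" for y
  proof -
    have "k * (lat x * (k * form k ?q y)) \<le> k * (lat x * 1)"
    proof -
      have "lat x * (k * (k * form k ?q y)) \<le> lat x * (k * 1)"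
        using lat_nonneg[OF x]
        by (intro mult_left_mono cos_values_le form_model_space k L_model q that)
      then show ?thesis by (simp only: mult.left_commute[of k "lat x"])
    qed
    then have "arccos_curv k (lat x * 1) \<le> arccos_curv k (lat x * (k * form k ?q y))"
    proof (cases "lat x = 0")
      case False
      then have "lat x > 0" using lat_nonneg[OF x] by simp
      then show ?thesis
        using \<open>k * (lat x * (k * form k ?q y)) \<le> k * (lat x * 1)\<close>
          arccos_curv_le_iff[OF k mult_cos_values mult_cos_values, OF \<open>lat x > 0\<close> lat_values[OF x]
            one_cos_values \<open>lat x > 0\<close> lat_values[OF x] form_model_space[OF k L_model[OF q] L_model[OF that]]]
        by simp
    qed simp
    then show ?thesis unfolding dist[OF that] dist[OF q] qq .
  qed
  have "geodesic_dist k x ?q = arccos_curv k (lat x)" unfolding dist[OF q] qq by simp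
  then have "(\<exists>y\<in>L. geodesic_dist k x y \<le> R) \<longleftrightarrow> arccos_curv k (lat x) \<le> R"
    using min q by (metis order_trans)
  then show ?thesis using L_model by (auto simp: geodesic_ball_def disjoint_iff)
qed

text \<open>The hypothesis \<open>iff\<close>, applied to the distance of \<open>y\<close> from the
  projected centre, identifies the section with the ball of radius \<open>s\<close>. Since
  \<open>L\<close> contains a point at distance exactly \<open>s\<close>, every other admissible
  radius is at least \<open>s\<close>, so the infimum is a minimum.\<close>

lemma section_radius_eqI:
  assumes x: "x \<in> model_space k" and s: "s \<in> half_circle k"
    and iff: "\<And>t. t \<in> half_circle k \<Longrightarrow> arccos_curv k (lat x * cos_curv k t) \<le> R \<longleftrightarrow> t \<le> s"
  shows "section_radius k L x R = s"
proof -
  let ?q = "orth_proj k L x"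
  have q: "?q \<in> L" by (rule arg_min_on_L(1)[OF x])
  have mem: "y \<in> geodesic_ball k x R \<inter> L \<longleftrightarrow> geodesic_dist k ?q y \<le> s" if y: "y \<in> L" for y
  proof -
    have v: "k * form k ?q y \<in> cos_values k" by (intro form_model_space k L_model q y)
    have "geodesic_dist k x y = arccos_curv k (lat x * cos_curv k (geodesic_dist k ?q y))"
      unfolding geodesic_dist_arccos_curv form_orth_proj[OF x y] cos_curv_arccos_curv[OF k v] ..
    then show ?thesis
      using iff[of "geodesic_dist k ?q y"] y L_model[OF y] arccos_curv_half_circle[OF k v]
      by (simp add: geodesic_ball_def geodesic_dist_arccos_curv)
  qed
  let ?S = "{s'. 0 \<le> s' \<and> geodesic_ball k x R \<inter> L = geodesic_ball k ?q s' \<inter> L}"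
  have "s \<in> ?S" using mem s L_model by (auto simp: half_circle_def geodesic_ball_def)
  moreover have "s \<le> s'" if "s' \<in> ?S" for s'
  proof -
    obtain y where y: "y \<in> L" "k * form k ?q y = cos_curv k s" by (rule geodesic_in_L[OF q])
    then have d: "geodesic_dist k ?q y = s"
      by (simp add: geodesic_dist_arccos_curv arccos_curv_cos_curv k s)
    then have "y \<in> geodesic_ball k ?q s' \<inter> L" using mem[OF y(1)] that by auto
    then show ?thesis using d by (simp add: geodesic_ball_def)
  qed
  ultimately show ?thesis unfolding section_radius_def by (intro cInf_eq_minimum)
qed

lemma section_radius_eq:
  assumes x: "x \<in> model_space k" "lat x > 0" and R: "arccos_curv k (lat x) \<le> R"
  shows "section_radius k L x R = section_length k (lat x) R"
  by (intro section_radius_eqI section_length_half_circle le_section_length_iff x k lat_values R)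

text \<open>All points of \<open>L\<close> are a quarter circle away from a pole, so a ball around
  it that reaches \<open>L\<close> contains all of \<open>L\<close>. The smallest radius describing
  \<open>L\<close> as a ball in itself is half a great circle. The value is used to make the section
  map measurable.\<close>

lemma section_radius_pole:
  assumes x: "x \<in> model_space k" "lat x = 0" and R: "arccos_curv k (lat x) \<le> R"
  shows "section_radius k L x R = pi / sqrt k"
  using pole_eq(1)[OF x] R
  by (intro section_radius_eqI x) (auto simp: half_circle_def x(2) field_simps)

end

section \<open>Splitting off a coordinate\<close>

text \<open>In the Leibniz formula every permutation that moves \<open>i0\<close> meets a zero of
  row \<open>i0\<close>. The remaining ones are permutations of the other indices and are
  transported along \<open>\<sigma>\<close> to the smaller index type.\<close>

lemma det_unit_row:
  fixes A :: "real ^ 'n::finite ^ 'n" and \<sigma> :: "'m::finite \<Rightarrow> 'n"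
  assumes \<sigma>: "bij_betw \<sigma> UNIV (UNIV - {i0})"
    and A: "A $ i0 $ i0 = 1" "\<And>j. j \<noteq> i0 \<Longrightarrow> A $ i0 $ j = 0"
  shows "det A = det (\<chi> a b. A $ \<sigma> a $ \<sigma> b)"
proof -
  let ?f = "\<lambda>p. of_int (sign p) * (\<Prod>i\<in>UNIV. A $ i $ p i)"
  have inj: "inj_on \<sigma> UNIV" using \<sigma> by (simp add: bij_betw_def)
  have bij: "bij_betw (map_permutation UNIV \<sigma>) {q. q permutes UNIV} {p. p permutes (UNIV - {i0})}"
  proof (rule bij_betwI)
    show "map_permutation UNIV \<sigma> \<in> {q. q permutes UNIV} \<rightarrow> {p. p permutes (UNIV - {i0})}"
      using map_permutation_permutes[OF \<sigma>] by auto
    show "map_permutation (UNIV - {i0}) (inv_into UNIV \<sigma>)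
        \<in> {p. p permutes (UNIV - {i0})} \<rightarrow> {q. q permutes UNIV}"
      using map_permutation_permutes[OF bij_betw_inv_into[OF \<sigma>]] by auto
    show "map_permutation (UNIV - {i0}) (inv_into UNIV \<sigma>) (map_permutation UNIV \<sigma> q) = q"
      if "q \<in> {q. q permutes UNIV}" for q
      using that inj by (intro map_permutation_compose_inv[OF \<sigma>]) auto
    show "map_permutation UNIV \<sigma> (map_permutation (UNIV - {i0}) (inv_into UNIV \<sigma>) p) = p"
      if "p \<in> {p. p permutes (UNIV - {i0})}" for p
      using that \<sigma> by (intro map_permutation_compose_inv[OF bij_betw_inv_into[OF \<sigma>]])
        (auto simp: bij_betw_def f_inv_into_f)
  qed
  have "det A = sum ?f {p. p permutes UNIV}" by (simp add: det_def)
  also have "\<dots> = sum ?f {p. p permutes (UNIV - {i0})}"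
  proof (rule sum.mono_neutral_right)
    show "{p. p permutes (UNIV - {i0})} \<subseteq> {p. p permutes (UNIV :: 'n set)}"
      by (auto intro: permutes_subset)
    show "\<forall>p\<in>{p. p permutes UNIV} - {p. p permutes (UNIV - {i0})}. ?f p = 0"
    proof
      fix p assume p: "p \<in> {p. p permutes UNIV} - {p. p permutes (UNIV - {i0})}"
      have "p i0 \<noteq> i0"
      proof
        assume "p i0 = i0"
        then have "p permutes (UNIV - {i0})"
          using p by (auto simp: permutes_def)
        then show False using p by simp
      qed
      then have "(\<Prod>i\<in>UNIV. A $ i $ p i) = 0"
        using A(2) by (intro prod_zero) auto
      then show "?f p = 0" by simp
    qed
  qed (simp add: finite_permutations)
  also have "\<dots> = (\<Sum>q | q permutes UNIV. ?f (map_permutation UNIV \<sigma> q))"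
    by (rule sum.reindex_bij_betw[OF bij, symmetric])
  also have "\<dots> = (\<Sum>q | q permutes UNIV. of_int (sign q) * (\<Prod>a\<in>UNIV. A $ \<sigma> a $ \<sigma> (q a)))"
  proof (rule sum.cong)
    fix q :: "'m \<Rightarrow> 'm" assume "q \<in> {q. q permutes UNIV}"
    then have q: "q permutes UNIV" by simp
    let ?p = "map_permutation UNIV \<sigma> q"
    have "?p i0 = i0"
      using map_permutation_permutes[OF \<sigma> q] by (simp add: permutes_def)
    then have "(\<Prod>i\<in>UNIV. A $ i $ ?p i) = (\<Prod>i\<in>UNIV - {i0}. A $ i $ ?p i)"
      using A(1) by (subst prod.remove[of _ i0]) auto
    also have "\<dots> = (\<Prod>a\<in>UNIV. A $ \<sigma> a $ ?p (\<sigma> a))"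
      by (rule prod.reindex_bij_betw[OF \<sigma>, symmetric])
    also have "\<dots> = (\<Prod>a\<in>UNIV. A $ \<sigma> a $ \<sigma> (q a))"
      by (simp add: map_permutation_apply[OF inj])
    finally show "?f ?p = of_int (sign q) * (\<Prod>a\<in>UNIV. A $ \<sigma> a $ \<sigma> (q a))"
      using sign_map_permutation[OF inj q] by simp
  qed simp
  also have "\<dots> = det (\<chi> a b. A $ \<sigma> a $ \<sigma> b)" by (simp add: det_def)
  finally show ?thesis .
qed

text \<open>The index types of the charts of the space and of \<open>L\<close> are unrelated types.
  The injection \<open>\<sigma>\<close> identifies the indices of \<open>L\<close> with all indices
  except \<open>i0\<close>, which is reserved for the normal direction.\<close>

locale coordinate_split =
  fixes i0 :: "'n::finite" and \<sigma> :: "'m::finite \<Rightarrow> 'n"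
  assumes \<sigma>: "bij_betw \<sigma> UNIV (UNIV - {i0})"
begin

definition base :: "real ^ 'n \<Rightarrow> real ^ 'm" where
  "base x = (\<chi> j. x $ \<sigma> j)"

definition join :: "real ^ 'm \<Rightarrow> real \<Rightarrow> real ^ 'n" where
  "join u h = (\<chi> i. if i = i0 then h else u $ inv_into UNIV \<sigma> i)"

lemma \<sigma>_neq [simp]: "\<sigma> j \<noteq> i0" "i0 \<noteq> \<sigma> j"
  using \<sigma> by (auto simp: bij_betw_def)

lemma \<sigma>_eq_iff [simp]: "\<sigma> i = \<sigma> j \<longleftrightarrow> i = j"
  using \<sigma> by (auto simp: bij_betw_def inj_on_def)

lemma index_cases: "P i0 \<Longrightarrow> (\<And>j. P (\<sigma> j)) \<Longrightarrow> P i"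
proof (cases "i = i0")
  case False
  then have "i \<in> range \<sigma>" using \<sigma> by (simp add: bij_betw_def)
  then show "(\<And>j. P (\<sigma> j)) \<Longrightarrow> P i" by blast
qed simp

lemma join_i0 [simp]: "join u h $ i0 = h"
  by (simp add: join_def)

lemma join_\<sigma> [simp]: "join u h $ \<sigma> j = u $ j"
  using \<sigma> by (simp add: join_def bij_betw_def)

lemma base_nth [simp]: "base x $ j = x $ \<sigma> j"
  by (simp add: base_def)

lemma base_join [simp]: "base (join u h) = u"
  by (simp add: vec_eq_iff)

lemma join_base [simp]: "join (base x) (x $ i0) = x"
  unfolding vec_eq_iff by (auto intro: index_cases)

lemma vec_eqI_split: "base x = base y \<Longrightarrow> x $ i0 = y $ i0 \<Longrightarrow> x = y"
  by (metis join_base)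

lemma linear_base: "linear base"
  by (rule linearI) (simp_all add: vec_eq_iff)

lemma base_axis [simp]: "base (axis i0 1) = 0" "base (axis (\<sigma> j) 1) = axis j 1"
  by (simp_all add: vec_eq_iff axis_def)

lemma continuous_on_join [continuous_intros]:
  assumes "continuous_on S f" "continuous_on S g"
  shows "continuous_on S (\<lambda>x. join (f x) (g x))"
proof -
  have "continuous_on S (\<lambda>x. join (f x) (g x) $ i)" for i
    by (rule index_cases[of _ i]) (auto intro!: continuous_intros assms)
  then show ?thesis
    using continuous_on_vec_lambda[of S "\<lambda>i x. join (f x) (g x) $ i"] by simp
qed

lemma continuous_on_base [continuous_intros]:
  "continuous_on S f \<Longrightarrow> continuous_on S (\<lambda>x. base (f x))"
  unfolding base_def by (intro continuous_intros)

lemma measurable_join [measurable]: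
  "(\<lambda>(u, h). join u h) \<in> borel_measurable (lborel \<Otimes>\<^sub>M lborel)"
proof -
  have "(\<lambda>(u, h). join u h) \<in> borel_measurable borel"
    by (rule borel_measurable_continuous_onI) (auto simp: case_prod_beta intro!: continuous_intros)
  then show ?thesis by (simp add: lborel_prod)
qed

lemma prod_split: "(\<Prod>i\<in>UNIV. f i) = f i0 * (\<Prod>j\<in>UNIV. f (\<sigma> j))" for f :: "'n \<Rightarrow> 'b::comm_monoid_mult"
  by (subst prod.remove[of _ i0]) (simp_all add: prod.reindex_bij_betw[OF \<sigma>])

text \<open>Both measures give a box the product of its side lengths, and this determines Lebesgue
  measure. It turns integrals in the chart of the space into iterated integrals over
  \<open>L\<close> and the height.\<close>

lemma lborel_split: "lborel = distr (lborel \<Otimes>\<^sub>M lborel) borel (\<lambda>(u, h). join u h)"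
proof (rule lborel_eqI)
  fix l u :: "real ^ 'n"
  assume le: "\<And>b. b \<in> Basis \<Longrightarrow> l \<bullet> b \<le> u \<bullet> b"
  have le': "l $ i \<le> u $ i" for i using le[of "axis i 1"] by (simp add: inner_axis)
  have basis: "(\<Prod>b\<in>Basis. (u - l) \<bullet> b) = (\<Prod>i\<in>UNIV. u $ i - l $ i)" for l u :: "real ^ 'i::finite"
  proof -
    have "inj_on (\<lambda>i. axis i 1 :: real ^ 'i) UNIV" by (auto simp: inj_on_def axis_eq_axis)
    then have "(\<Prod>b\<in>range (\<lambda>i. axis i 1). (u - l) \<bullet> b) = (\<Prod>i\<in>UNIV. u $ i - l $ i)"
      by (subst prod.reindex) (simp_all add: inner_axis)
    also have "range (\<lambda>i. axis i 1 :: real ^ 'i) = Basis" by (auto simp: Basis_vec_def)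
    finally show ?thesis .
  qed
  have all: "(\<forall>i. P i) \<longleftrightarrow> P i0 \<and> (\<forall>j. P (\<sigma> j))" for P
    by (auto intro: index_cases)
  have "(\<lambda>(u, h). join u h) -` box l u = box (base l) (base u) \<times> box (l $ i0) (u $ i0)"
    by (auto simp: mem_box_cart all[of "\<lambda>i. _ i < _ i \<and> _ i"] all)
  then have "emeasure (distr (lborel \<Otimes>\<^sub>M lborel) borel (\<lambda>(u, h). join u h)) (box l u) =
      emeasure (lborel \<Otimes>\<^sub>M lborel) (box (base l) (base u) \<times> box (l $ i0) (u $ i0))"
    by (subst emeasure_distr) (auto simp: space_pair_measure)
  also have "\<dots> = emeasure lborel (box (base l) (base u)) * emeasure lborel (box (l $ i0) (u $ i0))"
    by (intro lborel.emeasure_pair_measure_Times) auto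
  also have "emeasure lborel (box (base l) (base u)) = (\<Prod>b\<in>Basis. (base u - base l) \<bullet> b)"
    using le' by (intro emeasure_lborel_box) (auto simp: Basis_vec_def inner_axis)
  also have "\<dots> = (\<Prod>j\<in>UNIV. u $ \<sigma> j - l $ \<sigma> j)" by (simp add: basis)
  also have "emeasure lborel (box (l $ i0) (u $ i0)) = u $ i0 - l $ i0"
    using le' by simp
  also have "ennreal (\<Prod>j\<in>UNIV. u $ \<sigma> j - l $ \<sigma> j) * ennreal (u $ i0 - l $ i0)
      = ennreal (\<Prod>i\<in>UNIV. u $ i - l $ i)"
    using le' by (simp add: prod_split mult.commute prod_nonneg flip: ennreal_mult)
  finally show "emeasure (distr (lborel \<Otimes>\<^sub>M lborel) borel (\<lambda>(u, h). join u h)) (box l u) =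
      ennreal (\<Prod>b\<in>Basis. (u - l) \<bullet> b)" by (simp add: basis)
qed simp

lemma nn_integral_split:
  assumes [measurable]: "f \<in> borel_measurable borel"
  shows "(\<integral>\<^sup>+x. f x \<partial>lborel) = (\<integral>\<^sup>+u. \<integral>\<^sup>+h. f (join u h) \<partial>lborel \<partial>lborel)"
proof -
  have "(\<integral>\<^sup>+x. f x \<partial>lborel) = (\<integral>\<^sup>+x. f x \<partial>distr (lborel \<Otimes>\<^sub>M lborel) borel (\<lambda>(u, h). join u h))"
    by (subst lborel_split) simp
  also have "\<dots> = (\<integral>\<^sup>+x. f (case x of (u, h) \<Rightarrow> join u h) \<partial>(lborel \<Otimes>\<^sub>M lborel))"
    by (intro nn_integral_distr) measurable
  also have "\<dots> = (\<integral>\<^sup>+u. \<integral>\<^sup>+h. f (join u h) \<partial>lborel \<partial>lborel)"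
    by (subst lborel.nn_integral_fst[symmetric]) simp_all
  finally show ?thesis .
qed

end

section \<open>Charts\<close>

text \<open>The inverse of \<open>sin_curv k\<close> on \<open>half_strip k\<close>. Clamping the
  argument to the interval from -1 to 1 makes the function continuous on the whole line and changes
  nothing at the heights of points of the space.\<close>

definition arcsin_curv :: "real \<Rightarrow> real \<Rightarrow> real" where
  "arcsin_curv k a = (if k > 0 then arcsin (max (-1) (min 1 (sqrt k * a))) / sqrt k
     else arsinh (sqrt (- k) * a) / sqrt (- k))"

text \<open>The signed distances from \<open>L\<close> that occur away from the poles.\<close>

definition half_strip :: "real \<Rightarrow> real set" where
  "half_strip k = {h. ereal \<bar>h\<bar> < quarter_length k}"

lemma half_strip_iff: "h \<in> half_strip k \<longleftrightarrow> (k > 0 \<longrightarrow> sqrt k * \<bar>h\<bar> < pi / 2)"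
  by (auto simp: half_strip_def quarter_length_def field_simps)

lemma continuous_on_arcsin_curv [continuous_intros]:
  fixes f :: "'a::t2_space \<Rightarrow> real"
  assumes "continuous_on S f"
  shows "continuous_on S (\<lambda>x. arcsin_curv k (f x))"
  using assms unfolding arcsin_curv_def divide_inverse
  by (cases "k > 0")
    (auto intro!: continuous_on_mult continuous_on_const continuous_on_max continuous_on_min
      continuous_on_arcsin continuous_on_compose2[OF continuous_on_arsinh[of UNIV]])

lemma cos_curv_pos:
  assumes "h \<in> half_strip k"
  shows "cos_curv k h > 0"
proof (cases "k > 0")
  case True
  with assms have "\<bar>sqrt k * h\<bar> < pi / 2" by (simp add: half_strip_iff abs_mult)
  with True show ?thesis by (auto simp: cos_curv_def intro!: cos_gt_zero_pi)
qed (simp add: cos_curv_def)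

lemma arcsin_curv_sin_curv:
  assumes "k \<noteq> 0" "h \<in> half_strip k"
  shows "arcsin_curv k (sin_curv k h) = h"
proof (cases "k > 0")
  case True
  with assms have "\<bar>sqrt k * h\<bar> < pi / 2" by (simp add: half_strip_iff abs_mult)
  with True show ?thesis by (simp add: arcsin_curv_def sin_curv_def arcsin_sin)
qed (use assms in \<open>simp add: arcsin_curv_def sin_curv_def arsinh_sinh_real\<close>)

lemma sin_curv_arcsin_curv:
  assumes "k \<noteq> 0" "k * a\<^sup>2 < 1"
  shows "sin_curv k (arcsin_curv k a) = a" "cos_curv k (arcsin_curv k a) = sqrt (1 - k * a\<^sup>2)"
    "arcsin_curv k a \<in> half_strip k"
proof -
  have "sin_curv k (arcsin_curv k a) = a \<and> cos_curv k (arcsin_curv k a) = sqrt (1 - k * a\<^sup>2)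
    \<and> arcsin_curv k a \<in> half_strip k"
  proof (cases "k > 0")
    case True
    have "(sqrt k * a)\<^sup>2 < 1" using True assms by (simp add: power_mult_distrib)
    then have a: "\<bar>sqrt k * a\<bar> < 1" by (simp add: abs_square_less_1)
    then have e: "arcsin_curv k a = arcsin (sqrt k * a) / sqrt k"
      using True by (simp add: arcsin_curv_def abs_less_iff)
    have "\<bar>arcsin (sqrt k * a)\<bar> < pi / 2"
      using arcsin_lt_bounded[of "sqrt k * a"] a unfolding abs_less_iff by linarith
    with a True show ?thesis
      by (simp add: e sin_curv_def cos_curv_def half_strip_iff abs_less_iff cos_arcsin power_mult_distrib)
  next
    case False
    then show ?thesis using assms
      by (simp add: arcsin_curv_def sin_curv_def cos_curv_def half_strip_iff cosh_arsinh_real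
          power_mult_distrib add.commute)
  qed
  then show "sin_curv k (arcsin_curv k a) = a" "cos_curv k (arcsin_curv k a) = sqrt (1 - k * a\<^sup>2)"
    "arcsin_curv k a \<in> half_strip k" by auto
qed

lemmas has_derivative_cos_curv [derivative_intros] = DERIV_cos_curv[THEN DERIV_compose_FDERIV]
lemmas has_derivative_sin_curv [derivative_intros] = DERIV_sin_curv[THEN DERIV_compose_FDERIV]

text \<open>The vectors \<open>b i\<close> form an orthonormal basis of the tangent space of
  \<open>L\<close> at \<open>p\<close>. Near \<open>p\<close>, \<open>L\<close> is parametrized as a
  graph over this tangent space.\<close>

locale hypersurface_chart = geodesic_hypersurface k n L
  for k :: real and n :: "'n::finite ambient" and L :: "'n ambient set" +
  fixes p :: "'n ambient" and b :: "'m::finite \<Rightarrow> 'n ambient"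
  assumes p: "p \<in> L" and bb: "form k (b i) (b j) = (if i = j then 1 else 0)"
    and bn: "form k (b i) n = 0" and bp: "form k (b i) p = 0"
    and spanning: "form k v n = 0 \<Longrightarrow> form k v p = 0 \<Longrightarrow> (\<Sum>i\<in>UNIV. form k v (b i) *\<^sub>R b i) = v"
begin

definition emb :: "real ^ 'm \<Rightarrow> 'n ambient" where
  "emb u = (\<Sum>i\<in>UNIV. (u $ i) *\<^sub>R b i)"

definition coord :: "'n ambient \<Rightarrow> real ^ 'm" where
  "coord x = (\<chi> i. form k x (b i))"

text \<open>The coefficient of \<open>p\<close> in the graph: a vector
  \<open>emb u + t *\<^sub>R p\<close> has square \<open>u \<bullet> u + t^2 / k\<close>, and
  equating this with \<open>1 / k\<close> gives \<open>t^2 = 1 - k * (u \<bullet> u)\<close>. The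
  positive root selects the part of \<open>L\<close> around \<open>p\<close>.\<close>

definition rho :: "real ^ 'm \<Rightarrow> real" where
  "rho u = sqrt (1 - k * (u \<bullet> u))"

definition dom :: "(real ^ 'm) set" where
  "dom = {u. k * (u \<bullet> u) < 1}"

definition phi :: "real ^ 'm \<Rightarrow> 'n ambient" where
  "phi u = emb u + rho u *\<^sub>R p"

definition phi' :: "real ^ 'm \<Rightarrow> real ^ 'm \<Rightarrow> 'n ambient" where
  "phi' u v = emb v - (k * (u \<bullet> v) / rho u) *\<^sub>R p"

lemma pp: "form k p p = 1 / k" and pn: "form k p n = 0"
  using model_spaceD(1)[OF L_model[OF p]] L_normal[OF p] by auto

lemma linear_emb: "linear emb"
  by (rule linearI) (simp_all add: emb_def scaleR_add_left sum.distrib scaleR_sum_right)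

lemma bounded_linear_emb: "bounded_linear emb"
  using linear_emb by (simp add: linear_conv_bounded_linear)

lemma form_emb: "form k (emb u) p = 0" "form k p (emb u) = 0" "form k (emb u) n = 0" "form k n (emb u) = 0"
  "form k (emb u) (b j) = u $ j" "form k (emb u) (emb v) = u \<bullet> v"
proof -
  show 1: "form k (emb u) p = 0" and 2: "form k (emb u) n = 0"
    by (simp_all add: emb_def form.sum_left form.scaleR_left bn bp)
  show "form k p (emb u) = 0" "form k n (emb u) = 0" using 1 2 by (simp_all add: form_commute)
  show e: "form k (emb u) (b j) = u $ j" for u j
    by (simp add: emb_def form.sum_left form.scaleR_left bb if_distrib[of "\<lambda>x. _ * x"] sum.delta cong: if_cong)
  have "form k (emb u) (emb v) = (\<Sum>i\<in>UNIV. v $ i * form k (emb u) (b i))"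
    unfolding emb_def[of v] by (simp add: form.sum_right form.scaleR_right)
  then show "form k (emb u) (emb v) = u \<bullet> v" by (simp add: e inner_vec_def mult.commute)
qed

lemma rho_pos: "u \<in> dom \<Longrightarrow> rho u > 0" and rho_square: "u \<in> dom \<Longrightarrow> (rho u)\<^sup>2 = 1 - k * (u \<bullet> u)"
  by (simp_all add: rho_def dom_def)

lemma coord_add: "coord (x + y) = coord x + coord y" and coord_scale: "coord (r *\<^sub>R x) = r *\<^sub>R coord x"
  and coord_diff: "coord (x - y) = coord x - coord y"
  by (simp_all add: coord_def vec_eq_iff form_simps)

lemma coord_simps [simp]: "coord (emb u) = u" "coord p = 0" "coord n = 0"
  by (simp_all add: coord_def vec_eq_iff form_emb bp bn form_commute[of k p] form_commute[of k n])

lemma coord_phi [simp]: "coord (phi u) = u" "coord (phi' u v) = v"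
  by (simp_all add: phi_def phi'_def coord_add coord_diff coord_scale)

lemma form_phi:
  assumes "u \<in> dom"
  shows "form k (phi u) (phi u) = 1 / k" "form k (phi u) n = 0" "form k n (phi u) = 0"
    "k * form k (phi u) p = rho u" "form k (phi' u v) (phi u) = 0" "form k (phi u) (phi' u v) = 0"
    "form k (phi' u v) n = 0" "form k n (phi' u v) = 0"
proof -
  have "form k (phi u) (phi u) = u \<bullet> u + (rho u)\<^sup>2 / k"
    by (simp add: phi_def form_simps form_emb pp power2_eq_square)
  then show "form k (phi u) (phi u) = 1 / k" using k rho_square[OF assms] by (simp add: field_simps)
  show "k * form k (phi u) p = rho u" using k by (simp add: phi_def form_simps form_emb pp)
  show 1: "form k (phi u) n = 0" "form k (phi' u v) n = 0"
    by (simp_all add: phi_def phi'_def form_simps form_emb pn)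
  show 2: "form k (phi' u v) (phi u) = 0" using k rho_pos[OF assms]
    by (simp add: phi_def phi'_def form_simps form_emb pp inner_commute)
  show "form k n (phi u) = 0" "form k (phi u) (phi' u v) = 0" "form k n (phi' u v) = 0"
    using 1 2 by (simp_all add: form_commute)
qed

lemma phi_in_L:
  assumes "u \<in> dom"
  shows "phi u \<in> L"
  using model_spaceI[OF L_model[OF p] form_phi(1)[OF assms]] form_phi(2,4)[OF assms] rho_pos[OF assms]
  by (simp add: L_def)

lemma phi_coord:
  assumes y: "y \<in> L" and yp: "k * form k y p > 0"
  shows "coord y \<in> dom" "phi (coord y) = y"
proof -
  let ?t = "k * form k y p"
  define w where "w = y - ?t *\<^sub>R p"
  have "form k w n = 0" "form k w p = 0"
    using k by (simp_all add: w_def form_simps pn pp L_normal y)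
  then have "(\<Sum>i\<in>UNIV. form k w (b i) *\<^sub>R b i) = w" by (rule spanning)
  moreover have "coord w = coord y" by (simp add: w_def coord_diff coord_scale)
  then have "form k w (b i) = coord y $ i" for i by (metis coord_def vec_lambda_beta)
  ultimately have w: "emb (coord y) = w" by (simp add: emb_def)
  then have y_eq: "y = emb (coord y) + ?t *\<^sub>R p" by (simp add: w_def)
  have "form k (emb u + t *\<^sub>R p) (emb u + t *\<^sub>R p) = u \<bullet> u + t\<^sup>2 / k" for u t
    by (simp add: form_simps form_emb pp power2_eq_square)
  from this[of "coord y" ?t] have "1 / k = coord y \<bullet> coord y + ?t\<^sup>2 / k"
    unfolding y_eq[symmetric] using model_spaceD(1)[OF L_model[OF y]] by simp
  then have t: "1 - k * (coord y \<bullet> coord y) = ?t\<^sup>2" using k by (simp add: field_simps)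
  have "0 < ?t\<^sup>2" using yp by (rule zero_less_power)
  then show "coord y \<in> dom" unfolding dom_def t[symmetric] by simp
  show "phi (coord y) = y" using yp y_eq by (simp add: phi_def rho_def t)
qed

text \<open>For \<open>k > 0\<close> the chart covers the open hemisphere of \<open>L\<close>
  centred at \<open>p\<close>; for \<open>k < 0\<close> it covers all of \<open>L\<close>.\<close>

lemma phi_image: "phi ` dom = {y \<in> L. k * form k y p > 0}"
proof (intro equalityI subsetI)
  fix y assume "y \<in> phi ` dom"
  then show "y \<in> {y \<in> L. k * form k y p > 0}" using phi_in_L form_phi(4) rho_pos by auto
next
  fix y assume "y \<in> {y \<in> L. k * form k y p > 0}"
  then show "y \<in> phi ` dom" using phi_coord[of y] by (intro image_eqI[of _ _ "coord y"]) auto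
qed

lemma open_dom: "open dom"
  unfolding dom_def by (intro open_Collect_less continuous_intros)

lemma continuous_on_emb [continuous_intros]: "continuous_on S f \<Longrightarrow> continuous_on S (\<lambda>x. emb (f x))"
  by (rule bounded_linear.continuous_on[OF bounded_linear_emb])

lemma continuous_on_rho [continuous_intros]: "continuous_on S f \<Longrightarrow> continuous_on S (\<lambda>x. rho (f x))"
  unfolding rho_def by (intro continuous_intros)

lemma continuous_on_phi [continuous_intros]: "continuous_on S f \<Longrightarrow> continuous_on S (\<lambda>x. phi (f x))"
  unfolding phi_def by (intro continuous_intros)

lemma continuous_on_coord [continuous_intros]: "continuous_on S f \<Longrightarrow> continuous_on S (\<lambda>x. coord (f x))"
  unfolding coord_def by (intro continuous_intros)

lemma continuous_on_phi':
  assumes "continuous_on S f" "continuous_on S g" "f ` S \<subseteq> dom"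
  shows "continuous_on S (\<lambda>x. phi' (f x) (g x))"
  unfolding phi'_def using assms by (intro continuous_intros) (auto dest!: rho_pos)

lemma has_derivative_phi:
  assumes "u \<in> dom"
  shows "(phi has_derivative phi' u) (at u)"
proof -
  have r: "1 - k * (u \<bullet> u) > 0" using assms by (simp add: dom_def)
  have "((\<lambda>u. emb u + rho u *\<^sub>R p) has_derivative phi' u) (at u)"
    unfolding rho_def
    by (rule derivative_eq_intros bounded_linear.has_derivative[OF bounded_linear_emb] r refl)+
       (use r in \<open>auto simp: phi'_def rho_def inner_commute field_simps\<close>)
  then show ?thesis by (simp add: phi_def[abs_def])
qed

lemma inj_phi': "inj (phi' u)"
  by (rule injI) (metis coord_phi(2))

lemma local_parametrization_phi: "local_parametrization L dom phi phi'"
  unfolding local_parametrization_def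
proof (intro conjI allI ballI)
  have "phi ` dom = L \<inter> {y. k * form k y p > 0}" by (auto simp: phi_image)
  moreover have "open {y. k * form k y p > 0}" by (intro open_Collect_less continuous_intros)
  ultimately show "openin (top_of_set L) (phi ` dom)" by (metis openin_open_Int)
  show "\<exists>\<psi>. homeomorphism dom (phi ` dom) phi \<psi>"
    by (rule exI[of _ coord]) (auto simp: homeomorphism_def image_image intro!: continuous_intros continuous_on_id)
  show "continuous_on dom (\<lambda>x. phi' x v)" for v
    by (rule continuous_on_phi') (auto intro: continuous_intros)
qed (auto simp: open_dom has_derivative_phi inj_phi')

end

text \<open>Fermi coordinates around \<open>L\<close>: the coordinates other than \<open>i0\<close>
  describe the foot in the chart \<open>phi\<close>, and the coordinate \<open>i0\<close> is the arc
  length along the geodesic that leaves the foot in direction \<open>n\<close>.\<close>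

locale product_chart = hypersurface_chart k n L p b + coordinate_split i0 \<sigma>
  for k :: real and n :: "'n::finite ambient" and L :: "'n ambient set"
    and p :: "'n ambient" and b :: "'m::finite \<Rightarrow> 'n ambient" and i0 :: 'n and \<sigma> :: "'m \<Rightarrow> 'n"
begin

definition Dom :: "(real ^ 'n) set" where
  "Dom = {x. base x \<in> dom \<and> x $ i0 \<in> half_strip k}"

definition Phi :: "real ^ 'n \<Rightarrow> 'n ambient" where
  "Phi x = cos_curv k (x $ i0) *\<^sub>R phi (base x) + sin_curv k (x $ i0) *\<^sub>R n"

definition Phi' :: "real ^ 'n \<Rightarrow> real ^ 'n \<Rightarrow> 'n ambient" where
  "Phi' x v = cos_curv k (x $ i0) *\<^sub>R phi' (base x) (base v)
     + (v $ i0) *\<^sub>R (cos_curv k (x $ i0) *\<^sub>R n - (k * sin_curv k (x $ i0)) *\<^sub>R phi (base x))"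

definition Psi :: "'n ambient \<Rightarrow> real ^ 'n" where
  "Psi z = join (coord (foot z)) (arcsin_curv k (height z))"

lemma Phi_facts:
  assumes x: "x \<in> Dom"
  shows "Phi x \<in> model_space k" "height (Phi x) = sin_curv k (x $ i0)"
    "lat (Phi x) = cos_curv k (x $ i0)" "foot (Phi x) = phi (base x)"
    "Psi (Phi x) = x" "k * form k (Phi x) p > 0"
proof -
  let ?c = "cos_curv k (x $ i0)" and ?s = "sin_curv k (x $ i0)"
  have u: "base x \<in> dom" and h: "x $ i0 \<in> half_strip k" using x by (auto simp: Dom_def)
  have c: "?c > 0" by (rule cos_curv_pos[OF h])
  have cs: "?c\<^sup>2 + k * ?s\<^sup>2 = 1" by (rule cos_sin_curv[OF k])
  have "form k (Phi x) (Phi x) = ?c\<^sup>2 / k + ?s\<^sup>2"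
    by (simp add: Phi_def form_simps form_phi[OF u] nn power2_eq_square)
  also have "\<dots> = (?c\<^sup>2 + k * ?s\<^sup>2) / k" using k by (simp add: field_simps)
  finally have PP: "form k (Phi x) (Phi x) = 1 / k" using cs by simp
  have "k * form k (Phi x) p = ?c * rho (base x)"
    using form_phi(4)[OF u] by (simp add: Phi_def form_simps form_commute[of k n p] pn)
  also have "\<dots> > 0" using c rho_pos[OF u] by simp
  finally show P: "k * form k (Phi x) p > 0" .
  show M: "Phi x \<in> model_space k" by (rule model_spaceI[OF L_model[OF p] PP P])
  show ht: "height (Phi x) = ?s" by (simp add: height_def Phi_def form_simps form_phi[OF u] nn)
  have "1 - k * ?s\<^sup>2 = ?c\<^sup>2" using cs by simp
  then show l: "lat (Phi x) = ?c" using c by (simp add: lat_def ht)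
  show f: "foot (Phi x) = phi (base x)" using c by (simp add: foot_def l ht) (simp add: Phi_def)
  show "Psi (Phi x) = x" by (simp add: Psi_def f ht arcsin_curv_sin_curv[OF k h])
qed

lemma lat_pos_if:
  assumes z: "z \<in> model_space k" and zp: "k * form k z p > 0"
  shows "lat z > 0" "k * form k (foot z) p > 0"
proof -
  have "lat z \<noteq> 0"
  proof
    assume "lat z = 0"
    then have "form k z p = 0"
      by (subst pole_eq(2)[OF z]) (simp_all add: form_simps L_normal p)
    then show False using zp by simp
  qed
  then show l: "lat z > 0" using lat_nonneg[OF z] by simp
  have "k * form k z p = lat z * (k * form k (foot z) p)"
    unfolding form_foot[OF p l] by (rule mult.left_commute)
  then show "k * form k (foot z) p > 0"
    using zp l by (metis zero_less_mult_pos)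
qed

lemma Psi_facts:
  assumes z: "z \<in> model_space k" and zp: "k * form k z p > 0"
  shows "Psi z \<in> Dom" "Phi (Psi z) = z"
proof -
  have l: "lat z > 0" and fp: "k * form k (foot z) p > 0" by (rule lat_pos_if[OF assms])+
  have fL: "foot z \<in> L" by (rule foot_in_L[OF z l])
  have "k * (height z)\<^sup>2 < 1" using lat_square[OF z] l
    by (metis diff_gt_0_iff_gt zero_less_power)
  note a = sin_curv_arcsin_curv[OF k this]
  show "Psi z \<in> Dom" using phi_coord(1)[OF fL fp] a by (simp add: Dom_def Psi_def)
  show "Phi (Psi z) = z"
    using a l phi_coord(2)[OF fL fp]
    by (simp add: Phi_def Psi_def flip: lat_def) (simp add: foot_def)
qed

lemma Phi_image: "Phi ` Dom = {z \<in> model_space k. k * form k z p > 0}"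
proof (intro equalityI subsetI)
  fix z assume "z \<in> {z \<in> model_space k. k * form k z p > 0}"
  then show "z \<in> Phi ` Dom" using Psi_facts[of z] by (intro image_eqI[of _ _ "Psi z"]) auto
qed (use Phi_facts in auto)

lemma open_half_strip: "open (half_strip k)"
proof -
  have "half_strip k = {h. k > 0 \<longrightarrow> sqrt k * \<bar>h\<bar> < pi / 2}" by (auto simp: half_strip_iff)
  moreover have "open {h. sqrt k * \<bar>h\<bar> < pi / 2}" by (intro open_Collect_less continuous_intros)
  ultimately show ?thesis by (cases "k > 0") auto
qed

lemma open_Dom: "open Dom"
proof -
  have "Dom = base -` dom \<inter> (\<lambda>x. x $ i0) -` half_strip k" by (auto simp: Dom_def)
  then show ?thesis
    using open_vimage[OF open_dom continuous_on_base[OF continuous_on_id]]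
      open_vimage[OF open_half_strip continuous_on_component[OF continuous_on_id]] by auto
qed

lemma continuous_on_foot: "continuous_on {z. lat z > 0} foot"
  unfolding foot_def lat_def height_def by (intro continuous_intros) auto

lemma has_derivative_Phi:
  assumes x: "x \<in> Dom"
  shows "(Phi has_derivative Phi' x) (at x)"
proof -
  have u: "base x \<in> dom" using x by (auto simp: Dom_def)
  have 1: "((\<lambda>x. x $ i0) has_derivative (\<lambda>v. v $ i0)) (at x)"
    by (rule bounded_linear.has_derivative[OF bounded_linear_vec_nth has_derivative_ident])
  have "(base has_derivative base) (at x)"
    using linear_base by (intro bounded_linear_imp_has_derivative) (simp add: linear_conv_bounded_linear)
  then have 2: "((\<lambda>x. phi (base x)) has_derivative (\<lambda>v. phi' (base x) (base v))) (at x)"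
    by (rule has_derivative_compose[of base base x UNIV phi, OF _ has_derivative_phi[OF u]])
  show ?thesis
    unfolding Phi_def[abs_def]
    by (rule derivative_eq_intros 1 2 k refl)+
       (auto simp: Phi'_def fun_eq_iff algebra_simps)
qed

text \<open>Pairing with \<open>n\<close> recovers the entry at \<open>i0\<close>, since all other
  terms are orthogonal to \<open>n\<close>. Then \<open>coord\<close>, which annihilates
  \<open>n\<close> and inverts \<open>phi'\<close>, recovers the remaining entries.\<close>

lemma inj_Phi':
  assumes x: "x \<in> Dom"
  shows "inj (Phi' x)"
proof (rule injI)
  fix v w assume eq: "Phi' x v = Phi' x w"
  have u: "base x \<in> dom" and h: "x $ i0 \<in> half_strip k" using x by (auto simp: Dom_def)
  have c: "cos_curv k (x $ i0) > 0" by (rule cos_curv_pos[OF h])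
  have "form k (Phi' x v) n = cos_curv k (x $ i0) * v $ i0" for v
    by (simp add: Phi'_def form_simps form_phi[OF u] nn)
  then have vw: "v $ i0 = w $ i0" using eq c by (metis mult_cancel_left less_irrefl)
  have "coord (Phi' x v) = cos_curv k (x $ i0) *\<^sub>R base v - (v $ i0 * k * sin_curv k (x $ i0)) *\<^sub>R base x" for v
    by (simp add: Phi'_def coord_add coord_diff coord_scale)
  then have "base v = base w" using eq c vw by (metis add_right_cancel diff_add_cancel scaleR_left_imp_eq less_irrefl)
  then show "v = w" using vw by (rule vec_eqI_split)
qed

lemma local_parametrization_Phi: "local_parametrization (model_space k) Dom Phi Phi'"
  unfolding local_parametrization_def
proof (intro conjI allI ballI)
  have "Phi ` Dom = model_space k \<inter> {y. k * form k y p > 0}" by (auto simp: Phi_image)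
  moreover have "open {y. k * form k y p > 0}" by (intro open_Collect_less continuous_intros)
  ultimately show "openin (top_of_set (model_space k)) (Phi ` Dom)" by (metis openin_open_Int)
  have "continuous_on (Phi ` Dom) Psi"
    unfolding Psi_def[abs_def] height_def
    using Phi_facts(3) cos_curv_pos
    by (intro continuous_intros continuous_on_subset[OF continuous_on_foot])
       (auto simp: Dom_def)
  moreover have "continuous_on Dom Phi"
    unfolding Phi_def[abs_def] by (intro continuous_intros)
  ultimately have "homeomorphism Dom (Phi ` Dom) Phi Psi"
    by (auto simp: homeomorphism_def Phi_facts image_image)
  then show "\<exists>\<psi>. homeomorphism Dom (Phi ` Dom) Phi \<psi>" by blast
  show "continuous_on Dom (\<lambda>x. Phi' x v)" for v
    unfolding Phi'_def by (intro continuous_intros continuous_on_phi') (auto simp: Dom_def)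
qed (auto simp: open_Dom has_derivative_Phi inj_Phi')

text \<open>The metric is block diagonal: the derivative in direction \<open>i0\<close> is a unit
  vector in the span of \<open>n\<close> and the foot, to which the tangent vectors of
  \<open>L\<close> at the foot are orthogonal. Each of the \<open>CARD('m)\<close> remaining rows
  carries a factor \<open>cos_curv^2\<close>; after the square root this is the weight
  \<open>cos_curv ^ (d - 1)\<close> of the theorem.\<close>

lemma det_metric_Phi:
  assumes x: "x \<in> Dom"
  shows "det (metric_matrix k (Phi' x)) =
    (cos_curv k (x $ i0)) ^ (2 * CARD('m)) * det (metric_matrix k (phi' (base x)))"
proof -
  let ?c = "cos_curv k (x $ i0)" and ?s = "sin_curv k (x $ i0)"
  let ?A = "metric_matrix k (Phi' x)" and ?G = "metric_matrix k (phi' (base x))"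
  have u: "base x \<in> dom" using x by (auto simp: Dom_def)
  have lin0: "phi' (base x) 0 = 0" using linear_0[OF linear_emb] by (simp add: phi'_def)
  have D0: "Phi' x (axis i0 1) = ?c *\<^sub>R n - (k * ?s) *\<^sub>R phi (base x)"
    by (simp add: Phi'_def lin0)
  have Dj: "Phi' x (axis (\<sigma> j) 1) = ?c *\<^sub>R phi' (base x) (axis j 1)" for j
    by (simp add: Phi'_def) (simp add: axis_def)
  have "form k (Phi' x (axis i0 1)) (Phi' x (axis i0 1)) = ?c\<^sup>2 + k * ?s\<^sup>2"
    using k by (simp add: D0 form_simps form_phi[OF u] nn power2_eq_square)
  then have 00: "?A $ i0 $ i0 = 1" by (simp add: metric_matrix_def cos_sin_curv[OF k])
  have 0: "?A $ i0 $ \<sigma> j = 0" for j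
    by (simp add: metric_matrix_def D0 Dj form_simps form_phi[OF u])
  have jj: "?A $ \<sigma> i $ \<sigma> j = ?c\<^sup>2 * ?G $ i $ j" for i j
    by (simp add: metric_matrix_def Dj form_simps power2_eq_square)
  have "det ?A = det (\<chi> i j. ?A $ \<sigma> i $ \<sigma> j)"
  proof (rule det_unit_row[OF \<sigma> 00])
    have "j \<noteq> i0 \<longrightarrow> ?A $ i0 $ j = 0" for j by (rule index_cases[of _ j]) (simp_all add: 0)
    then show "?A $ i0 $ j = 0" if "j \<noteq> i0" for j using that by blast
  qed
  also have "\<dots> = det (\<chi> i. ?c\<^sup>2 *s (?G $ i))"
    by (rule arg_cong[of _ _ det]) (simp add: vec_eq_iff jj)
  also have "\<dots> = (\<Prod>i\<in>(UNIV :: 'm set). ?c\<^sup>2) * det (\<chi> i. ?G $ i)"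
    by (rule det_rows_mul)
  finally show ?thesis by (simp add: power_mult)
qed

end

section \<open>Volume in product coordinates\<close>

text \<open>The tangent space \<open>V\<close> has dimension \<open>d - 1\<close>, because adding
  the single vector \<open>p\<close> to it spans the hyperplane \<open>W\<close> orthogonal to
  \<open>n\<close>. The form is positive definite on \<open>V\<close>, as \<open>V\<close> is
  orthogonal to \<open>p\<close>.\<close>

lemma (in geodesic_hypersurface) chart_exists:
  assumes p: "p \<in> L" and card: "CARD('m::finite) = CARD('n) - 1"
  obtains b :: "'m::finite \<Rightarrow> 'n ambient" where "hypersurface_chart k n L p b"
proof -
  define n' where "n' = (fst n, sgn k * snd n)"
  have fn: "form k v n = n' \<bullet> v" for v
    by (simp add: form_def n'_def inner_prod_def inner_commute)
  have "n' \<noteq> 0" using nn fn[of n] by auto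
  define W where "W = {v. form k v n = 0}"
  have dimW: "dim W = CARD('n)"
    using dim_hyperplane[OF \<open>n' \<noteq> 0\<close>] by (simp add: fn W_def)
  define V where "V = {v. form k v n = 0 \<and> form k v p = 0}"
  note pp = model_spaceD(1)[OF L_model[OF p]]
  have V: "subspace V" by (auto simp: subspace_def V_def form_simps)
  have pos: "form k v v > 0" if "v \<in> V" "v \<noteq> 0" for v
    using form_orthogonal_pos[OF k pp] that by (simp add: V_def)
  have "p \<notin> V" using k pp by (simp add: V_def)
  then have p_span: "p \<notin> span V" using V by (simp add: span_eq_iff[THEN iffD2])
  have WV: "W \<subseteq> span (insert p V)"
  proof
    fix w assume "w \<in> W"
    then have "w - (k * form k w p) *\<^sub>R p \<in> V"
      using k pp by (simp add: V_def W_def form_simps L_normal p)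
    then show "w \<in> span (insert p V)" unfolding span_insert by (auto intro: span_base)
  qed
  have "insert p V \<subseteq> W" by (auto simp: V_def W_def L_normal p)
  then have "dim (insert p V) \<le> dim W" by (rule dim_subset)
  moreover have "dim W \<le> dim (insert p V)" using dim_subset[OF WV] by simp
  moreover have "dim (insert p V) = Suc (dim V)" using p_span by (simp add: dim_insert)
  ultimately have dimV: "dim V = CARD('m)" using dimW card by simp
  obtain b :: "'m \<Rightarrow> 'n ambient" where b: "\<And>i. b i \<in> V"
    "\<And>i j. form k (b i) (b j) = (if i = j then 1 else 0)"
    "\<And>v. v \<in> V \<Longrightarrow> (\<Sum>i\<in>UNIV. form k v (b i) *\<^sub>R b i) = v"
    using form_orthonormal_basis[OF V pos dimV] by blast
  have "hypersurface_chart k n L p b"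
    by unfold_locales (use b p in \<open>auto simp: V_def\<close>)
  then show ?thesis by (rule that)
qed

section \<open>Measurability in the charts and volumes of sets inside one chart\<close>

lemma (in geodesic_hypersurface) borel_measurable_geometry [measurable]:
  "height \<in> borel_measurable borel" "lat \<in> borel_measurable borel" "foot \<in> borel_measurable borel"
proof -
  show 1[measurable]: "height \<in> borel_measurable borel" unfolding height_def[abs_def] by measurable
  show 2[measurable]: "lat \<in> borel_measurable borel" unfolding lat_def[abs_def] by measurable
  show "foot \<in> borel_measurable borel" unfolding foot_def[abs_def] by measurable
qed

lemma borel_measurable_arcsin_curv [measurable]: "arcsin_curv k \<in> borel_measurable borel"
  by (intro borel_measurable_continuous_onI continuous_on_arcsin_curv continuous_on_id)

lemma borel_measurable_cos_curv [measurable]: "cos_curv k \<in> borel_measurable borel"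
  by (intro borel_measurable_continuous_onI continuous_on_cos_curv continuous_on_id)

lemma borel_half_strip [measurable]: "half_strip k \<in> sets borel"
  unfolding half_strip_def by measurable

context hypersurface_chart
begin

lemma borel_measurable_phi [measurable]: "phi \<in> borel_measurable borel" "dom \<in> sets borel"
  by (auto intro!: borel_measurable_continuous_onI continuous_intros continuous_on_id simp: open_dom)

lemma borel_measurable_det_phi' [measurable]:
  "(\<lambda>u. det (metric_matrix k (phi' u))) \<in> borel_measurable borel"
proof -
  have [measurable]: "rho \<in> borel_measurable borel"
    by (intro borel_measurable_continuous_onI continuous_intros continuous_on_id)
  have [measurable]: "(\<lambda>u. phi' u v) \<in> borel_measurable borel" for v
    unfolding phi'_def by measurable
  show ?thesis unfolding det_def metric_matrix_def by simp
qed

lemma preimage_phi_measurable: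
  assumes "A \<in> sets (restrict_space borel L)"
  shows "dom \<inter> phi -` A \<in> sets borel"
proof -
  obtain A0 where [measurable]: "A0 \<in> sets borel" and A: "A = L \<inter> A0"
    using assms by (auto simp: sets_restrict_space)
  have "dom \<inter> phi -` A = {u \<in> space borel. u \<in> dom \<and> phi u \<in> A0}"
    using phi_in_L by (auto simp: A)
  also have "\<dots> \<in> sets borel" by measurable
  finally show ?thesis .
qed

lemma emeasure_chart:
  assumes "riemannian_volume TYPE('m) k L \<mu>" "A \<in> sets \<mu>" "A \<subseteq> phi ` dom"
  shows "emeasure \<mu> A =
    (\<integral>\<^sup>+u\<in>dom \<inter> phi -` A. ennreal (sqrt (det (metric_matrix k (phi' u)))) \<partial>lborel)"
  using assms local_parametrization_phi unfolding riemannian_volume_def by blast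

text \<open>At the centre of the chart the metric matrix is the identity, so nearby the density is
  bounded and bounded away from zero, which makes the volume of a small open piece finite and
  positive. Removing finitely many points leaves it open and nonempty; \<open>F\<close> will be the
  set of projections of the poles.\<close>

lemma small_set_exists:
  assumes \<mu>: "riemannian_volume TYPE('m) k L \<mu>" and F: "finite F"
  obtains A where "A \<in> sets \<mu>" "A \<subseteq> phi ` dom" "A \<inter> F = {}" "0 < emeasure \<mu> A" "emeasure \<mu> A < \<infinity>"
proof -
  let ?g = "\<lambda>u. det (metric_matrix k (phi' u))"
  have cont: "continuous_on dom ?g"
    unfolding det_def metric_matrix_def vec_lambda_beta
    by (intro continuous_intros continuous_on_phi') auto
  have "0 \<in> dom" by (simp add: dom_def)
  have phi0: "phi' 0 v = emb v" for v by (simp add: phi'_def)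
  have "metric_matrix k (phi' 0) = mat 1"
    by (simp add: metric_matrix_def phi0 form_emb vec_eq_iff mat_def inner_axis_axis)
  then have g0: "?g 0 = 1" by simp
  \<comment> \<open>Any bounds on either side of the value 1 at the origin would do: the lower one
    gives positive volume, the upper one together with the bounded ball gives finite volume.\<close>
  define V0 where "V0 = (dom \<inter> ?g -` {1/2 <..< 2}) \<inter> ball 0 1"
  have "open V0" unfolding V0_def
    by (intro open_Int continuous_open_preimage cont open_dom) auto
  have "0 \<in> V0" using \<open>0 \<in> dom\<close> g0 by (simp add: V0_def)
  define V where "V = V0 - coord ` F"
  have "open V" unfolding V_def using \<open>open V0\<close> F by (intro open_Diff finite_imp_closed) auto
  have "V \<noteq> {}"
  proof
    assume "V = {}"
    then have "finite V0" using F by (auto simp: V_def intro: finite_subset)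
    then show False using finite_imp_not_open[of V0] \<open>open V0\<close> \<open>0 \<in> V0\<close> by auto
  qed
  have [measurable]: "V \<in> sets borel" using \<open>open V\<close> by simp
  have Vdom: "V \<subseteq> dom" by (auto simp: V_def V0_def)
  define A where "A = phi ` V"
  have "A = L \<inter> {y. k * form k y p > 0 \<and> coord y \<in> V}"
    using Vdom phi_in_L form_phi(4) rho_pos phi_coord(2) by (auto simp: A_def image_iff) metis
  moreover have "{y. k * form k y p > 0 \<and> coord y \<in> V} \<in> sets borel"
  proof -
    have [measurable]: "coord \<in> borel_measurable borel"
      by (intro borel_measurable_continuous_onI continuous_intros continuous_on_id)
    show ?thesis by measurable
  qed
  ultimately have "A \<in> sets (restrict_space borel L)" by (auto simp: sets_restrict_space)
  then have A: "A \<in> sets \<mu>" using \<mu> by (simp add: riemannian_volume_def)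
  have "A \<subseteq> phi ` dom" using Vdom by (auto simp: A_def)
  have "A \<inter> F = {}"
    unfolding A_def V_def by (auto simp: image_iff) (metis coord_phi(1))
  have "dom \<inter> phi -` A = V"
    using Vdom unfolding A_def by (auto simp: image_iff) (metis coord_phi(1))
  then have e: "emeasure \<mu> A = (\<integral>\<^sup>+u\<in>V. ennreal (sqrt (?g u)) \<partial>lborel)"
    using emeasure_chart[OF \<mu> A \<open>A \<subseteq> phi ` dom\<close>] by simp
  have g: "1 / 2 < ?g u" "?g u < 2" "u \<in> ball 0 1" if "u \<in> V" for u
    using that by (auto simp: V_def V0_def)
  have "emeasure \<mu> A \<le> (\<integral>\<^sup>+u. ennreal (sqrt 2) * indicator (ball 0 1) u \<partial>(lborel :: (real ^ 'm) measure))"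
    unfolding e using g by (intro nn_integral_mono) (auto simp: indicator_def intro!: ennreal_leI less_imp_le)
  also have "\<dots> < \<infinity>"
    using emeasure_lborel_ball_finite[of "0 :: real ^ 'm" 1]
    by (subst nn_integral_cmult_indicator) (auto simp: ennreal_mult_less_top)
  finally have fin: "emeasure \<mu> A < \<infinity>" .
  have "emeasure lborel V \<noteq> 0"
    using open_not_negligible[OF \<open>open V\<close> \<open>V \<noteq> {}\<close>]
    by (auto simp: negligible_iff_null_sets null_sets_completion_iff)
  moreover have "emeasure lborel V = 0" if "emeasure \<mu> A = 0"
  proof -
    have "AE u in lborel. ennreal (sqrt (?g u)) * indicator V u = 0"
      using that unfolding e by (subst (asm) nn_integral_0_iff_AE) auto
    then have "AE u in lborel. u \<notin> V"
    proof eventually_elim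
      case (elim u)
      show ?case
      proof
        assume "u \<in> V"
        then show False using elim g(1)[of u] by (simp add: indicator_def)
      qed
    qed
    then show ?thesis using AE_iff_null_sets[of V lborel] by (simp add: null_sets_def)
  qed
  ultimately have "0 < emeasure \<mu> A" by (auto simp: zero_less_iff_neq_zero)
  then show ?thesis using A \<open>A \<subseteq> phi ` dom\<close> \<open>A \<inter> F = {}\<close> fin by (intro that)
qed

end

context product_chart
begin

text \<open>The tube over \<open>A\<close> lies in the image of \<open>Phi\<close> and becomes a
  product of a set of base coordinates and \<open>B\<close>. The density splits into a factor on the
  base and a power of \<open>cos_curv\<close> in the height, so Tonelli's theorem separates the two
  integrals.\<close>

lemma emeasure_tube:
  assumes \<mu>: "riemannian_volume TYPE('n) k (model_space k) \<mu>"
    and \<mu>L: "riemannian_volume TYPE('m) k L \<mu>L"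
    and A: "A \<in> sets \<mu>L" "A \<subseteq> phi ` dom" and B[measurable]: "B \<in> sets borel" and BI: "B \<subseteq> half_strip k"
  shows "emeasure \<mu> {z \<in> model_space k. lat z > 0 \<and> foot z \<in> A \<and> arcsin_curv k (height z) \<in> B} =
    emeasure \<mu>L A * (\<integral>\<^sup>+h\<in>B. ennreal (cos_curv k h ^ CARD('m)) \<partial>lborel)"
proof -
  let ?E = "{z \<in> model_space k. lat z > 0 \<and> foot z \<in> A \<and> arcsin_curv k (height z) \<in> B}"
  let ?g = "\<lambda>u. det (metric_matrix k (phi' u))"
  define D where "D = dom \<inter> phi -` A"
  have AL: "A \<in> sets (restrict_space borel L)" using A \<mu>L by (simp add: riemannian_volume_def)
  have D[measurable]: "D \<in> sets borel" unfolding D_def by (rule preimage_phi_measurable[OF AL])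
  obtain A0 where A0[measurable]: "A0 \<in> sets borel" and A_eq: "A = L \<inter> A0"
    using AL by (auto simp: sets_restrict_space)
  have "?E = model_space k \<inter> {z. lat z > 0 \<and> foot z \<in> A0 \<and> arcsin_curv k (height z) \<in> B}"
    using foot_in_L by (auto simp: A_eq)
  moreover have "{z. lat z > 0 \<and> foot z \<in> A0 \<and> arcsin_curv k (height z) \<in> B} \<in> sets borel"
    by measurable
  ultimately have E: "?E \<in> sets \<mu>" using \<mu> by (auto simp: riemannian_volume_def sets_restrict_space)
  have E_image: "?E \<subseteq> Phi ` Dom"
  proof
    fix z assume z: "z \<in> ?E"
    then have "k * form k (foot z) p > 0" using A(2) by (auto simp: phi_image)
    then have "lat z * (k * form k (foot z) p) > 0" using z by simp
    then have "k * form k z p > 0"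
      using z form_foot[OF p, of z] by (simp add: mult.left_commute)
    then show "z \<in> Phi ` Dom" using z by (simp add: Phi_image)
  qed
  have pre: "x \<in> Dom \<inter> Phi -` ?E \<longleftrightarrow> base x \<in> D \<and> x $ i0 \<in> B" for x
    using BI Phi_facts[of x] cos_curv_pos[of "x $ i0"] arcsin_curv_sin_curv[OF k, of "x $ i0"]
    by (auto simp: D_def Dom_def)
  have sq: "sqrt (det (metric_matrix k (Phi' x))) = cos_curv k (x $ i0) ^ CARD('m) * sqrt (?g (base x))"
    if "x \<in> Dom" for x
  proof -
    have "cos_curv k (x $ i0) \<ge> 0"
      using that cos_curv_pos[of "x $ i0" k] by (auto simp: Dom_def)
    then have "sqrt (cos_curv k (x $ i0) ^ (2 * CARD('m))) = cos_curv k (x $ i0) ^ CARD('m)"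
      by (simp add: power_mult mult.commute[of 2] real_sqrt_power[symmetric] power_even_eq)
    then show ?thesis using det_metric_Phi[OF that] by (simp add: real_sqrt_mult)
  qed
  have [measurable]: "base \<in> borel_measurable borel"
    by (intro borel_measurable_continuous_onI continuous_intros continuous_on_id)
  have [measurable]: "(\<lambda>x :: real ^ 'n. x $ i0) \<in> borel_measurable borel"
    by (intro borel_measurable_continuous_onI continuous_intros continuous_on_id)
  let ?a = "\<lambda>u. ennreal (sqrt (?g u)) * indicator D u"
  let ?b = "\<lambda>h. ennreal (cos_curv k h ^ CARD('m)) * indicator B h"
  have "emeasure \<mu> ?E =
      (\<integral>\<^sup>+x\<in>Dom \<inter> Phi -` ?E. ennreal (sqrt (det (metric_matrix k (Phi' x)))) \<partial>lborel)"
    using \<mu> local_parametrization_Phi E E_image unfolding riemannian_volume_def by blast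
  also have "\<dots> = (\<integral>\<^sup>+x. ?a (base x) * ?b (x $ i0) \<partial>lborel)"
  proof (rule nn_integral_cong)
    fix x :: "real ^ 'n"
    show "ennreal (sqrt (det (metric_matrix k (Phi' x)))) * indicator (Dom \<inter> Phi -` ?E) x =
      ?a (base x) * ?b (x $ i0)"
    proof (cases "x \<in> Dom \<inter> Phi -` ?E")
      case True
      then have "x \<in> Dom" and "x $ i0 \<in> half_strip k" by (auto simp: Dom_def)
      then have "0 \<le> cos_curv k (x $ i0) ^ CARD('m)"
        by (intro zero_le_power less_imp_le cos_curv_pos)
      then show ?thesis using True pre[of x] \<open>x \<in> Dom\<close>
        by (simp add: sq ennreal_mult' mult.commute)
    next
      case False
      then have "\<not> (base x \<in> D \<and> x $ i0 \<in> B)" unfolding pre .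
      then have "indicator D (base x) * indicator B (x $ i0) = (0 :: ennreal)"
        by (auto simp: indicator_def)
      then show ?thesis
        unfolding indicator_simps(2)[OF False] by (auto simp: mult_eq_0_iff)
    qed
  qed
  also have "\<dots> = (\<integral>\<^sup>+u. \<integral>\<^sup>+h. ?a u * ?b h \<partial>lborel \<partial>lborel)"
    by (subst nn_integral_split) simp_all
  also have "\<dots> = (\<integral>\<^sup>+u. ?a u * (\<integral>\<^sup>+h. ?b h \<partial>lborel) \<partial>lborel)"
    by (intro nn_integral_cong nn_integral_cmult) measurable
  also have "\<dots> = (\<integral>\<^sup>+u. ?a u \<partial>lborel) * (\<integral>\<^sup>+h. ?b h \<partial>lborel)"
    by (intro nn_integral_multc) measurable
  also have "(\<integral>\<^sup>+u. ?a u \<partial>lborel) = emeasure \<mu>L A"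
    using emeasure_chart[OF \<mu>L A] by (simp add: D_def)
  finally show ?thesis .
qed

end

section \<open>Intensity measures\<close>

lemma emeasure_distr_count_space:
  fixes \<kappa> :: enat
  assumes "\<And>i. y i \<in> space S" "C \<in> sets S"
  shows "emeasure (distr (count_space {i. enat i < \<kappa>}) S y) C =
    (\<Sum>i. if enat i < \<kappa> \<and> y i \<in> C then 1 else 0)"
proof -
  let ?I = "{i. enat i < \<kappa>}"
  have y: "y \<in> count_space ?I \<rightarrow>\<^sub>M S" using assms by simp
  have "emeasure (distr (count_space ?I) S y) C =
      (\<integral>\<^sup>+z. indicator C z \<partial>distr (count_space ?I) S y)"
    using assms by simp
  also have "\<dots> = (\<integral>\<^sup>+i. indicator C (y i) \<partial>count_space ?I)"
    by (rule nn_integral_distr[OF y]) (use assms in simp)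
  also have "\<dots> = (\<integral>\<^sup>+i. indicator C (y i) * indicator ?I i \<partial>count_space UNIV)"
    by (rule nn_integral_count_space_indicator) simp
  also have "\<dots> = (\<integral>\<^sup>+i. (if enat i < \<kappa> \<and> y i \<in> C then 1 else 0) \<partial>count_space UNIV)"
    by (intro nn_integral_cong) (auto simp: indicator_def)
  finally show ?thesis by (simp add: nn_integral_count_space_nat)
qed

text \<open>The factorization of the joint law allows the marks to be integrated separately from the
  enumeration. The integrand sees only the mark with index \<open>i\<close>, and the projection of
  the product of copies of \<open>\<nu>\<close> to that coordinate is \<open>\<nu>\<close>
  itself.\<close>

lemma nn_integral_marking_term:
  fixes \<kappa> :: "'w \<Rightarrow> enat" and X :: "nat \<Rightarrow> 'w \<Rightarrow> 'a" and R :: "nat \<Rightarrow> 'w \<Rightarrow> real"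
  assumes P: "prob_space P" and \<nu>: "prob_space \<nu>" "sets \<nu> = sets borel"
    and [measurable]: "\<kappa> \<in> P \<rightarrow>\<^sub>M count_space UNIV" "\<And>i. X i \<in> P \<rightarrow>\<^sub>M S" "\<And>i. R i \<in> P \<rightarrow>\<^sub>M borel"
    and joint: "distr P ((count_space UNIV \<Otimes>\<^sub>M Pi\<^sub>M UNIV (\<lambda>_. S)) \<Otimes>\<^sub>M Pi\<^sub>M UNIV (\<lambda>_. borel))
        (\<lambda>\<omega>. ((\<kappa> \<omega>, \<lambda>i. X i \<omega>), \<lambda>i. R i \<omega>)) =
      distr P (count_space UNIV \<Otimes>\<^sub>M Pi\<^sub>M UNIV (\<lambda>_. S)) (\<lambda>\<omega>. (\<kappa> \<omega>, \<lambda>i. X i \<omega>)) \<Otimes>\<^sub>M Pi\<^sub>M UNIV (\<lambda>_. \<nu>)"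
    and C[measurable]: "C \<in> sets (S \<Otimes>\<^sub>M borel)"
  shows "(\<integral>\<^sup>+\<omega>. (if enat i < \<kappa> \<omega> \<and> (X i \<omega>, R i \<omega>) \<in> C then 1 else 0) \<partial>P) =
    (\<integral>\<^sup>+r. \<integral>\<^sup>+\<omega>. (if enat i < \<kappa> \<omega> \<and> (X i \<omega>, r) \<in> C then 1 else 0) \<partial>P \<partial>\<nu>)"
proof -
  interpret P: prob_space P by (rule P)
  interpret \<nu>: prob_space \<nu> by (rule \<nu>)
  let ?E = "count_space UNIV \<Otimes>\<^sub>M Pi\<^sub>M UNIV (\<lambda>_. S) :: (enat \<times> (nat \<Rightarrow> 'a)) measure"
  let ?PB = "Pi\<^sub>M UNIV (\<lambda>_. borel) :: (nat \<Rightarrow> real) measure" and ?PN = "Pi\<^sub>M UNIV (\<lambda>_. \<nu>) :: (nat \<Rightarrow> real) measure"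
  let ?e = "\<lambda>\<omega>. (\<kappa> \<omega>, \<lambda>i. X i \<omega>)"
  define F :: "(enat \<times> (nat \<Rightarrow> 'a)) \<times> (nat \<Rightarrow> real) \<Rightarrow> ennreal"
    where "F = (\<lambda>z. if enat i < fst (fst z) \<and> (snd (fst z) i, snd z i) \<in> C then 1 else 0)"
  define G where "G r = (\<integral>\<^sup>+\<omega>. (if enat i < \<kappa> \<omega> \<and> (X i \<omega>, r) \<in> C then 1 else 0) \<partial>P)" for r
  have PN: "sets ?PN = sets ?PB" by (intro sets_PiM_cong) (simp_all add: \<nu>)
  have [measurable]: "(\<lambda>\<omega> i. X i \<omega>) \<in> P \<rightarrow>\<^sub>M Pi\<^sub>M UNIV (\<lambda>_. S)" "(\<lambda>\<omega> i. R i \<omega>) \<in> P \<rightarrow>\<^sub>M ?PB"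
    by (rule measurable_abs_UNIV, measurable)+
  have [measurable]: "?e \<in> P \<rightarrow>\<^sub>M ?E" by measurable
  have lt[measurable]: "Measurable.pred (count_space UNIV) (\<lambda>m. enat i < m)" by simp
  have F[measurable]: "F \<in> borel_measurable (?E \<Otimes>\<^sub>M ?PB)"
    unfolding F_def by measurable
  interpret Q: prob_space "distr P ?E ?e" by (rule P.prob_space_distr) measurable
  interpret N: prob_space ?PN by (rule prob_space_PiM) (rule \<nu>.prob_space_axioms)
  interpret pair_sigma_finite "distr P ?E ?e" ?PN ..
  have G[measurable]: "G \<in> borel_measurable \<nu>"
    unfolding G_def[abs_def] measurable_cong_sets[OF \<nu>(2) refl] by measurable
  have "(\<integral>\<^sup>+\<omega>. (if enat i < \<kappa> \<omega> \<and> (X i \<omega>, R i \<omega>) \<in> C then 1 else 0) \<partial>P) =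
      (\<integral>\<^sup>+\<omega>. F (?e \<omega>, \<lambda>i. R i \<omega>) \<partial>P)" by (simp add: F_def)
  also have "\<dots> = (\<integral>\<^sup>+z. F z \<partial>distr P (?E \<Otimes>\<^sub>M ?PB) (\<lambda>\<omega>. (?e \<omega>, \<lambda>i. R i \<omega>)))"
    by (subst nn_integral_distr) simp_all
  also have "\<dots> = (\<integral>\<^sup>+z. F z \<partial>(distr P ?E ?e \<Otimes>\<^sub>M ?PN))" by (simp only: joint)
  also have "\<dots> = (\<integral>\<^sup>+r. \<integral>\<^sup>+e. F (e, r) \<partial>distr P ?E ?e \<partial>?PN)"
    by (rule nn_integral_snd[symmetric])
       (subst measurable_cong_sets[OF sets_pair_measure_cong[OF sets_distr PN] refl], rule F)
  also have "\<dots> = (\<integral>\<^sup>+r. G (r i) \<partial>?PN)"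
  proof (rule nn_integral_cong)
    fix r assume "r \<in> space ?PN"
    then have [measurable]: "r \<in> space ?PB" using sets_eq_imp_space_eq[OF PN] by simp
    show "(\<integral>\<^sup>+e. F (e, r) \<partial>distr P ?E ?e) = G (r i)"
      by (subst nn_integral_distr) (auto simp: F_def G_def)
  qed
  also have "\<dots> = (\<integral>\<^sup>+r. G r \<partial>distr ?PN \<nu> (\<lambda>r. r i))"
    by (subst nn_integral_distr) measurable
  also have "distr ?PN \<nu> (\<lambda>r. r i) = \<nu>"
    by (rule distr_PiM_component) (auto intro: \<nu>.prob_space_axioms)
  finally show ?thesis by (simp add: G_def)
qed

text \<open>Counting the points as a series lets the expectation act on one point at a time, where
  the mark is independent of the position. The iterated integral stands for the product of
  \<open>m\<close> and \<open>\<nu>\<close> and avoids forming a product with an \<open>m\<close>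
  not known to be sigma-finite. The identity of sigma-algebras holds only almost everywhere because
  \<open>\<xi>\<close> is described only almost everywhere.\<close>

lemma marking_intensity:
  assumes P: "prob_space P" and \<nu>: "prob_space \<nu>" "sets \<nu> = sets borel"
    and mark: "independent_marking P S \<eta> \<nu> \<xi>"
    and m: "has_intensity_measure P \<eta> m" "sets m = sets S"
    and C[measurable]: "C \<in> sets (S \<Otimes>\<^sub>M borel)"
  shows "AE \<omega> in P. sets (\<xi> \<omega>) = sets (S \<Otimes>\<^sub>M borel)"
    and "(\<integral>\<^sup>+\<omega>. emeasure (\<xi> \<omega>) C \<partial>P) = (\<integral>\<^sup>+r. emeasure m {x \<in> space S. (x, r) \<in> C} \<partial>\<nu>)"
proof -
  obtain \<kappa> X R where meas[measurable]: "\<kappa> \<in> P \<rightarrow>\<^sub>M count_space UNIV"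
      "\<And>i. X i \<in> P \<rightarrow>\<^sub>M S" "\<And>i. R i \<in> P \<rightarrow>\<^sub>M borel"
    and joint: "distr P ((count_space UNIV \<Otimes>\<^sub>M Pi\<^sub>M UNIV (\<lambda>_. S)) \<Otimes>\<^sub>M Pi\<^sub>M UNIV (\<lambda>_. borel))
        (\<lambda>\<omega>. ((\<kappa> \<omega>, \<lambda>i. X i \<omega>), \<lambda>i. R i \<omega>)) =
      distr P (count_space UNIV \<Otimes>\<^sub>M Pi\<^sub>M UNIV (\<lambda>_. S)) (\<lambda>\<omega>. (\<kappa> \<omega>, \<lambda>i. X i \<omega>)) \<Otimes>\<^sub>M Pi\<^sub>M UNIV (\<lambda>_. \<nu>)"
    and \<eta>: "AE \<omega> in P. \<eta> \<omega> = distr (count_space {i. enat i < \<kappa> \<omega>}) S (\<lambda>i. X i \<omega>)"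
    and \<xi>: "AE \<omega> in P. \<xi> \<omega> =
      distr (count_space {i. enat i < \<kappa> \<omega>}) (S \<Otimes>\<^sub>M borel) (\<lambda>i. (X i \<omega>, R i \<omega>))"
    using mark unfolding independent_marking_def Let_def by blast
  show "AE \<omega> in P. sets (\<xi> \<omega>) = sets (S \<Otimes>\<^sub>M borel)" using \<xi> by eventually_elim simp
  interpret P: prob_space P by (rule P)
  have lt[measurable]: "Measurable.pred (count_space UNIV) (\<lambda>m. enat i < m)" for i by simp
  have X: "X i \<omega> \<in> space S" if "\<omega> \<in> space P" for i \<omega>
    using measurable_space[OF meas(2) that] .
  have "(\<integral>\<^sup>+\<omega>. emeasure (\<xi> \<omega>) C \<partial>P) =
      (\<integral>\<^sup>+\<omega>. (\<Sum>i. if enat i < \<kappa> \<omega> \<and> (X i \<omega>, R i \<omega>) \<in> C then 1 else 0) \<partial>P)"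
  proof (rule nn_integral_cong_AE)
    show "AE \<omega> in P. emeasure (\<xi> \<omega>) C =
        (\<Sum>i. if enat i < \<kappa> \<omega> \<and> (X i \<omega>, R i \<omega>) \<in> C then 1 else 0)"
      using \<xi> AE_space
    proof eventually_elim
      case (elim \<omega>)
      then show ?case
        using emeasure_distr_count_space[of "\<lambda>i. (X i \<omega>, R i \<omega>)" "S \<Otimes>\<^sub>M borel" C "\<kappa> \<omega>"] X
        by (simp add: space_pair_measure)
    qed
  qed
  also have "\<dots> = (\<Sum>i. \<integral>\<^sup>+\<omega>. (if enat i < \<kappa> \<omega> \<and> (X i \<omega>, R i \<omega>) \<in> C then 1 else 0) \<partial>P)"
    by (intro nn_integral_suminf) measurable
  also have "\<dots> = (\<Sum>i. \<integral>\<^sup>+r. \<integral>\<^sup>+\<omega>. (if enat i < \<kappa> \<omega> \<and> (X i \<omega>, r) \<in> C then 1 else 0) \<partial>P \<partial>\<nu>)"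
    by (intro suminf_cong nn_integral_marking_term[OF P \<nu> meas joint C])
  also have "\<dots> = (\<integral>\<^sup>+r. (\<Sum>i. \<integral>\<^sup>+\<omega>. (if enat i < \<kappa> \<omega> \<and> (X i \<omega>, r) \<in> C then 1 else 0) \<partial>P) \<partial>\<nu>)"
    by (intro nn_integral_suminf[symmetric]) (simp only: measurable_cong_sets[OF \<nu>(2) refl], measurable)
  also have "\<dots> = (\<integral>\<^sup>+r. emeasure m {x \<in> space S. (x, r) \<in> C} \<partial>\<nu>)"
  proof (rule nn_integral_cong)
    fix r
    let ?C = "{x \<in> space S. (x, r) \<in> C}"
    have C': "?C \<in> sets S" by measurable
    have "(\<Sum>i. \<integral>\<^sup>+\<omega>. (if enat i < \<kappa> \<omega> \<and> (X i \<omega>, r) \<in> C then 1 else 0) \<partial>P) =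
        (\<integral>\<^sup>+\<omega>. (\<Sum>i. if enat i < \<kappa> \<omega> \<and> (X i \<omega>, r) \<in> C then 1 else 0) \<partial>P)"
      by (intro nn_integral_suminf[symmetric]) measurable
    also have "\<dots> = (\<integral>\<^sup>+\<omega>. emeasure (\<eta> \<omega>) ?C \<partial>P)"
    proof (rule nn_integral_cong_AE)
      show "AE \<omega> in P. (\<Sum>i. if enat i < \<kappa> \<omega> \<and> (X i \<omega>, r) \<in> C then 1 else 0) = emeasure (\<eta> \<omega>) ?C"
        using \<eta> AE_space
      proof eventually_elim
        case (elim \<omega>)
        then show ?case
          using emeasure_distr_count_space[of "\<lambda>i. X i \<omega>" S ?C "\<kappa> \<omega>", OF _ C'] X by simp
      qed
    qed
    also have "\<dots> = emeasure m ?C"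
      using m C' by (simp add: has_intensity_measure_def)
    finally show "(\<Sum>i. \<integral>\<^sup>+\<omega>. (if enat i < \<kappa> \<omega> \<and> (X i \<omega>, r) \<in> C then 1 else 0) \<partial>P) = emeasure m ?C" .
  qed
  finally show "(\<integral>\<^sup>+\<omega>. emeasure (\<xi> \<omega>) C \<partial>P) = (\<integral>\<^sup>+r. emeasure m {x \<in> space S. (x, r) \<in> C} \<partial>\<nu>)" .
qed

text \<open>Nothing useful is known about \<open>arccos_curv k\<close> outside
  \<open>cos_values k\<close>. Measurability proofs replace it by a Borel function on the whole line
  that agrees with it where it matters.\<close>

lemma arccos_curv_measurable_version:
  assumes "k \<noteq> 0"
  obtains g where "g \<in> borel_measurable borel" "\<And>c. c \<in> cos_values k \<Longrightarrow> g c = arccos_curv k c"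
proof (cases "k > 0")
  case True
  have "(\<lambda>c. arccos (max (-1) (min 1 c)) / sqrt k) \<in> borel_measurable borel"
    using True by (intro borel_measurable_continuous_onI continuous_intros) auto
  then show ?thesis
    by (rule that) (use True in \<open>auto simp: cos_values_def arccos_curv_def\<close>)
next
  case False
  have "(\<lambda>c. ln (c + sqrt (c\<^sup>2 - 1)) / sqrt (- k)) \<in> borel_measurable borel" by measurable
  then show ?thesis
    by (rule that) (use False in \<open>auto simp: cos_values_def arccos_curv_def arcosh_real_def\<close>)
qed

section \<open>The section map and the intensity measure of the induced process\<close>

context geodesic_hypersurface
begin

text \<open>For \<open>k > 0\<close> these are the arbitrarily chosen projections of the two poles,
  so the poles do not contribute to the count over a set avoiding them. For \<open>k < 0\<close>
  there are no poles, and only the finiteness of the set matters.\<close>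

definition pole_feet :: "'n ambient set" where
  "pole_feet = {orth_proj k L ((1 / sqrt k) *\<^sub>R n), orth_proj k L ((- 1 / sqrt k) *\<^sub>R n)}"

lemma orth_proj_eq:
  assumes x: "x \<in> model_space k"
  shows "orth_proj k L x = (if lat x = 0 then
    if height x > 0 then orth_proj k L ((1 / sqrt k) *\<^sub>R n) else orth_proj k L ((- 1 / sqrt k) *\<^sub>R n)
    else foot x)"
proof (cases "lat x = 0")
  case True
  note pole = pole_eq[OF x True]
  have "(height x)\<^sup>2 = (1 / sqrt k)\<^sup>2" using pole by (simp add: power_divide)
  then have "height x = 1 / sqrt k \<or> height x = - 1 / sqrt k" by (auto simp: power2_eq_iff)
  then show ?thesis
  proof
    assume h: "height x = 1 / sqrt k"
    then have "height x > 0" using pole(1) by simp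
    then show ?thesis using True by (subst pole(2)) (simp add: h)
  next
    assume h: "height x = - 1 / sqrt k"
    then have "\<not> height x > 0" using pole(1) by simp
    then show ?thesis using True by (subst pole(2)) (simp add: h)
  qed
next
  case False
  then show ?thesis using arg_min_on_L(2)[OF x] lat_nonneg[OF x] by simp
qed

lemma hits_measurable:
  "{(x, R). geodesic_ball k x R \<inter> L \<noteq> {}} \<inter> space (restrict_space borel (model_space k) \<Otimes>\<^sub>M borel)
    \<in> sets (restrict_space borel (model_space k) \<Otimes>\<^sub>M borel)"
proof -
  let ?S = "restrict_space borel (model_space k) :: 'n ambient measure"
  obtain g where [measurable]: "g \<in> borel_measurable borel"
    and g: "\<And>c. c \<in> cos_values k \<Longrightarrow> g c = arccos_curv k c"
    using arccos_curv_measurable_version[OF k] by blast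
  have [measurable]: "lat \<in> borel_measurable ?S" by (rule measurable_restrict_space1) measurable
  have "{(x, R). geodesic_ball k x R \<inter> L \<noteq> {}} \<inter> space (?S \<Otimes>\<^sub>M borel) =
      {z \<in> space (?S \<Otimes>\<^sub>M borel). g (lat (fst z)) \<le> snd z}"
  proof (rule set_eqI)
    fix z
    show "z \<in> {(x, R). geodesic_ball k x R \<inter> L \<noteq> {}} \<inter> space (?S \<Otimes>\<^sub>M borel) \<longleftrightarrow>
        z \<in> {z \<in> space (?S \<Otimes>\<^sub>M borel). g (lat (fst z)) \<le> snd z}"
      using ball_meets_L_iff[of "fst z" "snd z"] g[OF lat_values, of "fst z"]
      by (simp add: space_restrict_space space_pair_measure case_prod_beta mem_Times_iff) metis
  qed
  also have "\<dots> \<in> sets (?S \<Otimes>\<^sub>M borel)" by measurable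
  finally show ?thesis .
qed

text \<open>On the hitting set the map agrees with explicit Borel functions: the projection is
  \<open>foot\<close>, with two constant values at the poles, and the radius is
  \<open>section_length\<close>, with the constant \<open>pi / sqrt k\<close> at the poles. Off the
  hitting set the formula for the radius fails, hence the restricted space.\<close>

lemma section_map_measurable:
  "(\<lambda>(x, R). (orth_proj k L x, section_radius k L x R)) \<in>
    restrict_space (restrict_space borel (model_space k) \<Otimes>\<^sub>M borel) {(x, R). geodesic_ball k x R \<inter> L \<noteq> {}}
      \<rightarrow>\<^sub>M restrict_space borel L \<Otimes>\<^sub>M borel"
proof -
  let ?S = "restrict_space borel (model_space k) :: 'n ambient measure"
  let ?H = "{(x, R). geodesic_ball k x R \<inter> L \<noteq> {}}"
  let ?T = "restrict_space (?S \<Otimes>\<^sub>M borel) ?H"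
  obtain g where [measurable]: "g \<in> borel_measurable borel"
    and g: "\<And>c. c \<in> cos_values k \<Longrightarrow> g c = arccos_curv k c"
    using arccos_curv_measurable_version[OF k] by blast
  have geo[measurable]: "lat \<in> borel_measurable ?S" "height \<in> borel_measurable ?S" "foot \<in> borel_measurable ?S"
    by (rule measurable_restrict_space1, measurable)+
  define o1 where "o1 = (\<lambda>z :: 'n ambient \<times> real. if lat (fst z) = 0 then
    if height (fst z) > 0 then orth_proj k L ((1 / sqrt k) *\<^sub>R n) else orth_proj k L ((- 1 / sqrt k) *\<^sub>R n)
    else foot (fst z))"
  define s1 where "s1 = (\<lambda>z :: 'n ambient \<times> real. if lat (fst z) = 0 then pi / sqrt k else
    g (if k > 0 then max (-1) (cos (min (sqrt k * snd z) pi) / lat (fst z))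
       else cosh (sqrt (- k) * snd z) / lat (fst z)))"
  have "o1 \<in> borel_measurable (?S \<Otimes>\<^sub>M borel)" unfolding o1_def by measurable
  then have o1: "o1 \<in> borel_measurable ?T" by (rule measurable_restrict_space1)
  have [measurable]: "(cosh :: real \<Rightarrow> real) \<in> borel_measurable borel"
    by (intro borel_measurable_continuous_onI continuous_intros)
  have "s1 \<in> borel_measurable (?S \<Otimes>\<^sub>M borel)" unfolding s1_def by measurable
  then have s1: "s1 \<in> borel_measurable ?T" by (rule measurable_restrict_space1)
  have T: "z \<in> space ?T \<longleftrightarrow> fst z \<in> model_space k \<and> arccos_curv k (lat (fst z)) \<le> snd z" for z
    using ball_meets_L_iff[of "fst z" "snd z"]
    by (simp add: space_restrict_space space_pair_measure case_prod_beta mem_Times_iff) blast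
  have o_eq: "orth_proj k L (fst z) = o1 z" if "z \<in> space ?T" for z
    using that orth_proj_eq[of "fst z"] by (auto simp: T o1_def)
  have s_eq: "section_radius k L (fst z) (snd z) = s1 z" if "z \<in> space ?T" for z
  proof (cases "lat (fst z) = 0")
    case True
    then show ?thesis using that section_radius_pole[of "fst z" "snd z"] by (auto simp: T s1_def)
  next
    case False
    then have l: "lat (fst z) > 0" using lat_nonneg[of "fst z"] that by (auto simp: T)
    then show ?thesis
      using that section_radius_eq[of "fst z" "snd z"]
        g[OF section_length_argument[OF k l lat_values, of "snd z"]]
      by (auto simp: T s1_def section_length_def)
  qed
  have "(\<lambda>z. orth_proj k L (fst z)) \<in> ?T \<rightarrow>\<^sub>M restrict_space borel L"
  proof (rule measurable_restrict_space2)
    show "(\<lambda>z. orth_proj k L (fst z)) \<in> space ?T \<rightarrow> L"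
      using arg_min_on_L(1) by (auto simp: T)
    show "(\<lambda>z. orth_proj k L (fst z)) \<in> borel_measurable ?T"
      using o1 by (rule measurable_cong[THEN iffD1, rotated]) (rule o_eq[symmetric])
  qed
  moreover have "(\<lambda>z. section_radius k L (fst z) (snd z)) \<in> borel_measurable ?T"
    using s1 by (rule measurable_cong[THEN iffD1, rotated]) (rule s_eq[symmetric])
  ultimately show ?thesis unfolding case_prod_beta by (rule measurable_Pair)
qed

text \<open>The preimage \<open>C\<close> of \<open>A \<times> B\<close> under the section map lies
  in the hitting set, so the induced process counts in \<open>A \<times> B\<close> exactly the
  marked points in \<open>C\<close>. Campbell's formula then gives the expectation.\<close>

lemma induced_intensity:
  assumes P: "prob_space P" and \<nu>: "prob_space \<nu>" "sets \<nu> = sets borel"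
    and mark: "independent_marking P (restrict_space borel (model_space k)) \<eta> \<nu> \<xi>"
    and m: "has_intensity_measure P \<eta> m" "sets m = sets (restrict_space borel (model_space k))"
    and m': "has_intensity_measure P (induced_process k L \<xi>) m'"
      "sets m' = sets (restrict_space borel L \<Otimes>\<^sub>M borel)"
    and A: "A \<in> sets (restrict_space borel L)" and B: "B \<in> sets borel"
  shows "emeasure m' (A \<times> B) = (\<integral>\<^sup>+R. emeasure m {x \<in> model_space k.
    arccos_curv k (lat x) \<le> R \<and> orth_proj k L x \<in> A \<and> section_radius k L x R \<in> B} \<partial>\<nu>)"
proof -
  let ?S = "restrict_space borel (model_space k) :: 'n ambient measure"
  let ?H = "{(x, R). geodesic_ball k x R \<inter> L \<noteq> {}}"
  let ?f = "\<lambda>(x, R). (orth_proj k L x, section_radius k L x R)"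
  let ?T = "restrict_space (?S \<Otimes>\<^sub>M borel) ?H"
  let ?N = "restrict_space borel L \<Otimes>\<^sub>M borel :: ('n ambient \<times> real) measure"
  have AB: "A \<times> B \<in> sets ?N" using A B by (rule pair_measureI)
  define C where "C = ?f -` (A \<times> B) \<inter> space ?T"
  have "C \<in> sets ?T" unfolding C_def by (rule measurable_sets[OF section_map_measurable AB])
  then have C: "C \<in> sets (?S \<Otimes>\<^sub>M borel)" "C \<subseteq> ?H"
    using sets_restrict_space_iff[OF hits_measurable] by blast+
  have "emeasure m' (A \<times> B) = (\<integral>\<^sup>+\<omega>. emeasure (induced_process k L \<xi> \<omega>) (A \<times> B) \<partial>P)"
    using m' AB by (simp add: has_intensity_measure_def)
  also have "\<dots> = (\<integral>\<^sup>+\<omega>. emeasure (\<xi> \<omega>) C \<partial>P)"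
  proof (rule nn_integral_cong_AE)
    show "AE \<omega> in P. emeasure (induced_process k L \<xi> \<omega>) (A \<times> B) = emeasure (\<xi> \<omega>) C"
      using marking_intensity(1)[OF P \<nu> mark m C(1)]
    proof eventually_elim
      case (elim \<omega>)
      have sp: "space (\<xi> \<omega>) = space (?S \<Otimes>\<^sub>M borel)" by (rule sets_eq_imp_space_eq[OF elim])
      have f: "?f \<in> restrict_space (\<xi> \<omega>) ?H \<rightarrow>\<^sub>M ?N"
        using section_map_measurable measurable_cong_sets[OF sets_restrict_space_cong[OF elim] refl]
        by blast
      have "emeasure (induced_process k L \<xi> \<omega>) (A \<times> B) =
          emeasure (restrict_space (\<xi> \<omega>) ?H) (?f -` (A \<times> B) \<inter> space (restrict_space (\<xi> \<omega>) ?H))"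
        unfolding induced_process_def by (rule emeasure_distr[OF f AB])
      also have "?f -` (A \<times> B) \<inter> space (restrict_space (\<xi> \<omega>) ?H) = C"
        by (simp only: C_def space_restrict_space sp)
      also have "emeasure (restrict_space (\<xi> \<omega>) ?H) C = emeasure (\<xi> \<omega>) C"
        using hits_measurable C(2) by (intro emeasure_restrict_space) (simp_all add: sp elim)
      finally show ?case .
    qed
  qed
  also have "\<dots> = (\<integral>\<^sup>+R. emeasure m {x \<in> space ?S. (x, R) \<in> C} \<partial>\<nu>)"
    by (rule marking_intensity(2)[OF P \<nu> mark m C(1)])
  also have "\<dots> = (\<integral>\<^sup>+R. emeasure m {x \<in> model_space k.
    arccos_curv k (lat x) \<le> R \<and> orth_proj k L x \<in> A \<and> section_radius k L x R \<in> B} \<partial>\<nu>)"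
  proof (intro nn_integral_cong arg_cong[of _ _ "emeasure m"])
    fix R
    show "{x \<in> space ?S. (x, R) \<in> C} = {x \<in> model_space k.
      arccos_curv k (lat x) \<le> R \<and> orth_proj k L x \<in> A \<and> section_radius k L x R \<in> B}"
      using ball_meets_L_iff[of _ R]
      by (intro Collect_cong) (simp add: C_def space_restrict_space space_pair_measure, blast)
  qed
  finally show ?thesis .
qed

end

section \<open>The radius distribution of the sections\<close>

text \<open>The signed distances from \<open>L\<close> at which the centre of a ball of radius
  \<open>R\<close> may lie for the ball to hit \<open>L\<close> in a section with radius in
  \<open>B\<close>, poles excluded.\<close>

definition hit_heights :: "real \<Rightarrow> real \<Rightarrow> real set \<Rightarrow> real set" where
  "hit_heights k R B = {h \<in> half_strip k. \<bar>h\<bar> \<le> R \<and> section_length k (cos_curv k h) R \<in> B}"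

lemma half_strip_half_circle: "h \<in> half_strip k \<Longrightarrow> \<bar>h\<bar> \<in> half_circle k"
  using less_trans[of "sqrt k * \<bar>h\<bar>" "pi / 2" pi]
  by (simp add: half_strip_iff half_circle_def less_imp_le)

lemma arccos_curv_cos_curv_abs:
  assumes "k \<noteq> 0" "h \<in> half_strip k"
  shows "arccos_curv k (cos_curv k h) = \<bar>h\<bar>"
  using arccos_curv_cos_curv[OF assms(1) half_strip_half_circle[OF assms(2)]] by simp

lemma hit_heights_pred_measurable:
  assumes k: "k \<noteq> 0" and [measurable]: "B \<in> sets borel"
  shows "Measurable.pred (borel \<Otimes>\<^sub>M borel) (\<lambda>(R, h). h \<in> hit_heights k R B)"
proof -
  obtain g where [measurable]: "g \<in> borel_measurable borel"
    and g: "\<And>c. c \<in> cos_values k \<Longrightarrow> g c = arccos_curv k c"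
    using arccos_curv_measurable_version[OF k] by blast
  have [measurable]: "(cosh :: real \<Rightarrow> real) \<in> borel_measurable borel"
    by (intro borel_measurable_continuous_onI continuous_intros)
  have "h \<in> hit_heights k R B \<longleftrightarrow> h \<in> half_strip k \<and> \<bar>h\<bar> \<le> R \<and>
    g (if k > 0 then max (-1) (cos (min (sqrt k * R) pi) / cos_curv k h)
       else cosh (sqrt (- k) * R) / cos_curv k h) \<in> B" for h R
  proof (cases "h \<in> half_strip k \<and> \<bar>h\<bar> \<le> R")
    case True
    then show ?thesis
      using g[OF section_length_argument[OF k cos_curv_pos cos_curv_values, of h R]]
      by (auto simp: hit_heights_def section_length_def arccos_curv_cos_curv_abs k)
  qed (auto simp: hit_heights_def)
  then show ?thesis by (simp add: case_prod_beta)
qed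

lemma hit_heights_measurable:
  assumes "k \<noteq> 0" "B \<in> sets borel"
  shows "hit_heights k R B \<in> sets borel"
proof -
  have [measurable]: "Measurable.pred (borel \<Otimes>\<^sub>M borel) (\<lambda>(R, h). h \<in> hit_heights k R B)"
    by (rule hit_heights_pred_measurable[OF assms])
  have "Measurable.pred borel (\<lambda>h. case (R, h) of (R, h) \<Rightarrow> h \<in> hit_heights k R B)"
    by measurable
  then show ?thesis by (simp add: pred_def)
qed

text \<open>The poles are ruled out because their projections miss \<open>A\<close>. At any other
  point the hitting condition and the section radius depend only on the height, so the set is a tube
  over \<open>A\<close> whose heights form \<open>hit_heights k R B\<close>.\<close>

lemma (in product_chart) emeasure_hits:
  assumes \<mu>: "riemannian_volume TYPE('n) k (model_space k) \<mu>"
    and \<mu>L: "riemannian_volume TYPE('m) k L \<mu>L"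
    and A: "A \<in> sets \<mu>L" "A \<subseteq> phi ` dom" "A \<inter> pole_feet = {}" and B: "B \<in> sets borel"
  shows "emeasure \<mu> {x \<in> model_space k.
      arccos_curv k (lat x) \<le> R \<and> orth_proj k L x \<in> A \<and> section_radius k L x R \<in> B} =
    emeasure \<mu>L A * (\<integral>\<^sup>+h\<in>hit_heights k R B. ennreal (cos_curv k h ^ CARD('m)) \<partial>lborel)"
proof -
  have "{x \<in> model_space k. arccos_curv k (lat x) \<le> R \<and> orth_proj k L x \<in> A \<and> section_radius k L x R \<in> B}
    = {z \<in> model_space k. lat z > 0 \<and> foot z \<in> A \<and> arcsin_curv k (height z) \<in> hit_heights k R B}"
  proof (rule Collect_cong)
    fix x
    show "x \<in> model_space k \<and> arccos_curv k (lat x) \<le> R \<and> orth_proj k L x \<in> A \<and> section_radius k L x R \<in> B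
      \<longleftrightarrow> x \<in> model_space k \<and> lat x > 0 \<and> foot x \<in> A \<and> arcsin_curv k (height x) \<in> hit_heights k R B"
    proof (cases "x \<in> model_space k \<and> lat x > 0")
      case True
      then have x: "x \<in> model_space k" and l: "lat x > 0" by auto
      have "k * (height x)\<^sup>2 < 1" using lat_square[OF x] l
        by (metis diff_gt_0_iff_gt zero_less_power)
      note a = sin_curv_arcsin_curv[OF k this, folded lat_def]
      have "arccos_curv k (lat x) = \<bar>arcsin_curv k (height x)\<bar>"
        using arccos_curv_cos_curv_abs[OF k a(3)] a(2) by simp
      then show ?thesis
        using x l a section_radius_eq[OF x l, of R] arg_min_on_L(2)[OF x l]
        by (auto simp: hit_heights_def)
    next
      case False
      have "orth_proj k L x \<notin> A" if "x \<in> model_space k"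
        using that False orth_proj_eq[OF that] A(3) lat_nonneg[OF that] by (auto simp: pole_feet_def)
      then show ?thesis using False by auto
    qed
  qed
  then show ?thesis
    using emeasure_tube[OF \<mu> \<mu>L A(1,2) hit_heights_measurable[OF k B], of R]
    by (auto simp: hit_heights_def)
qed

lemma (in geodesic_hypersurface) radius_relation:
  fixes \<mu> \<mu>L :: "'n ambient measure"
  assumes card: "CARD('m::finite) = CARD('n) - 1"
    and \<mu>: "riemannian_volume TYPE('n) k (model_space k) \<mu>"
    and \<mu>L: "riemannian_volume TYPE('m) k L \<mu>L"
    and P: "prob_space P" and \<nu>: "prob_space \<nu>" "sets \<nu> = sets borel"
    and \<nu>': "prob_space \<nu>'" "sets \<nu>' = sets borel"
    and mark: "independent_marking P (restrict_space borel (model_space k)) \<eta> \<nu> \<xi>"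
    and m: "has_intensity_measure P \<eta> (scale_measure N \<mu>)"
    and m': "has_intensity_measure P (induced_process k L \<xi>) (scale_measure N' (\<mu>L \<Otimes>\<^sub>M \<nu>'))"
    and B: "B \<in> sets borel"
  shows "N' * emeasure \<nu>' B = N * (\<integral>\<^sup>+R. (\<integral>\<^sup>+h\<in>hit_heights k R B.
    ennreal (cos_curv k h ^ (CARD('n) - 1)) \<partial>lborel) \<partial>\<nu>)"
proof -
  interpret \<nu>': prob_space \<nu>' by (rule \<nu>')
  obtain p where p: "p \<in> L" using L_nonempty by auto
  obtain b :: "'m \<Rightarrow> 'n ambient" where "hypersurface_chart k n L p b"
    by (rule chart_exists[OF p card])
  then interpret hypersurface_chart k n L p b .
  \<comment> \<open>Any index can serve as the normal coordinate.\<close>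
  obtain i0 :: 'n where True by simp
  have "card (UNIV - {i0}) = CARD('m)" using card by simp
  then obtain \<sigma> :: "'m \<Rightarrow> 'n" where \<sigma>: "bij_betw \<sigma> UNIV (UNIV - {i0})"
    using finite_same_card_bij[of "UNIV :: 'm set" "UNIV - {i0}"] by auto
  interpret product_chart k n L p b i0 \<sigma> by unfold_locales (rule \<sigma>)
  have sets: "sets \<mu> = sets (restrict_space borel (model_space k))" "sets \<mu>L = sets (restrict_space borel L)"
    using \<mu> \<mu>L by (auto simp: riemannian_volume_def)
  have "finite pole_feet" by (simp add: pole_feet_def)
  then obtain A where A: "A \<in> sets \<mu>L" "A \<subseteq> phi ` dom" "A \<inter> pole_feet = {}"
    and pos: "0 < emeasure \<mu>L A" "emeasure \<mu>L A < \<infinity>"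
    using small_set_exists[OF \<mu>L] by metis
  let ?W = "\<lambda>R. \<integral>\<^sup>+h\<in>hit_heights k R B. ennreal (cos_curv k h ^ CARD('m)) \<partial>lborel"
  have W: "?W \<in> borel_measurable \<nu>"
  proof -
    have [measurable]: "Measurable.pred (borel \<Otimes>\<^sub>M borel) (\<lambda>(R, h). h \<in> hit_heights k R B)"
      by (rule hit_heights_pred_measurable[OF k B])
    show ?thesis
      unfolding measurable_cong_sets[OF \<nu>(2) refl] indicator_def by measurable
  qed
  have "emeasure \<mu>L A * (N' * emeasure \<nu>' B) = emeasure (scale_measure N' (\<mu>L \<Otimes>\<^sub>M \<nu>')) (A \<times> B)"
    using A B \<nu>' by (simp add: \<nu>'.emeasure_pair_measure_Times mult.left_commute)
  also have "\<dots> = (\<integral>\<^sup>+R. N * (emeasure \<mu>L A * ?W R) \<partial>\<nu>)"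
    using induced_intensity[OF P \<nu> mark m _ m', of A B] A B
    by (simp add: sets \<nu>' emeasure_hits[OF \<mu> \<mu>L A B] cong: sets_pair_measure_cong)
  also have "\<dots> = N * (emeasure \<mu>L A * (\<integral>\<^sup>+R. ?W R \<partial>\<nu>))"
    using W by (simp add: nn_integral_cmult)
  finally have "emeasure \<mu>L A * (N' * emeasure \<nu>' B) = emeasure \<mu>L A * (N * (\<integral>\<^sup>+R. ?W R \<partial>\<nu>))"
    by (simp add: mult.left_commute)
  then show ?thesis
    using pos unfolding ennreal_mult_cancel_left by (auto simp: card)
qed

section \<open>The admissible heights as an interval bounded by \<open>alpha\<close>\<close>

lemma alpha_eq_arccos_curv:
  "k \<noteq> 0 \<Longrightarrow> alpha k t h = arccos_curv k (cos_curv k t / cos_curv k h)"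
  by (auto simp: alpha_def arccos_curv_def cos_curv_def)

lemma quarter_length_cos_curv:
  assumes "0 \<le> R" "ereal R \<le> quarter_length k"
  shows "R \<in> half_circle k" "0 \<le> cos_curv k R"
proof -
  have q: "sqrt k * R \<le> pi / 2" "- (pi / 2) \<le> sqrt k * R" "sqrt k * R \<le> pi" if "k > 0"
  proof -
    show le: "sqrt k * R \<le> pi / 2"
      using that assms by (simp add: quarter_length_def field_simps)
    have "0 \<le> sqrt k * R" using that assms by simp
    then show "- (pi / 2) \<le> sqrt k * R" "sqrt k * R \<le> pi"
      using le pi_gt_zero by linarith+
  qed
  show "R \<in> half_circle k" using assms q by (auto simp: half_circle_def)
  show "0 \<le> cos_curv k R" using q by (auto simp: cos_curv_def intro!: cos_ge_zero)
qed

lemma arccos_curv_le_quarter_length: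
  assumes "k \<noteq> 0" "c \<in> cos_values k"
  shows "ereal (arccos_curv k c) \<le> quarter_length k \<longleftrightarrow> 0 \<le> c"
proof (cases "k > 0")
  case True
  with assms have c: "\<bar>c\<bar> \<le> 1" by (auto simp: cos_values_def)
  have "arccos c \<le> pi / 2 \<longleftrightarrow> 0 \<le> c"
    using arccos_le_mono[of c 0] c by simp
  with True show ?thesis by (simp add: arccos_curv_def quarter_length_def field_simps)
qed (use assms in \<open>auto simp: quarter_length_def cos_values_def\<close>)

text \<open>Being at most a quarter circle means having nonnegative cosine, and dividing by the
  positive \<open>cos_curv k h\<close> preserves the sign. Below this threshold both truncations in
  \<open>section_length\<close> are inactive, so the untruncated quotient may be used.\<close>

lemma section_length_le_quarter:
  assumes k: "k \<noteq> 0" and h: "h \<in> half_strip k" "\<bar>h\<bar> \<le> R"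
  shows "ereal (section_length k (cos_curv k h) R) \<le> quarter_length k \<longleftrightarrow> ereal R \<le> quarter_length k"
    "ereal R \<le> quarter_length k \<Longrightarrow>
      section_length k (cos_curv k h) R = arccos_curv k (cos_curv k R / cos_curv k h)"
    "ereal R \<le> quarter_length k \<Longrightarrow> cos_curv k R / cos_curv k h \<in> cos_values k"
proof -
  let ?c = "cos_curv k h"
  have c: "?c > 0" by (rule cos_curv_pos[OF h(1)])
  have hit: "arccos_curv k ?c \<le> R" using h by (simp add: arccos_curv_cos_curv_abs k)
  note arg = section_length_argument[OF k c cos_curv_values hit]
  have R: "R \<ge> 0" using h by simp
  have eq: "(if k > 0 then max (-1) (cos (min (sqrt k * R) pi) / ?c) else cosh (sqrt (- k) * R) / ?c)
    = cos_curv k R / ?c" if "ereal R \<le> quarter_length k"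
  proof -
    have "0 \<le> cos_curv k R / ?c" using quarter_length_cos_curv(2)[OF R that] c by simp
    moreover have "k > 0 \<Longrightarrow> min (sqrt k * R) pi = sqrt k * R"
      using quarter_length_cos_curv(1)[OF R that] by (simp add: half_circle_def)
    ultimately show ?thesis
      by (cases "k > 0") (simp_all add: cos_curv_def[of k R] max_absorb2 order_trans[of "- 1" 0])
  qed
  show "section_length k ?c R = arccos_curv k (cos_curv k R / ?c)" "cos_curv k R / ?c \<in> cos_values k"
    if "ereal R \<le> quarter_length k"
    using eq[OF that] arg by (simp_all add: section_length_def)
  show "ereal (section_length k ?c R) \<le> quarter_length k \<longleftrightarrow> ereal R \<le> quarter_length k"
  proof (cases "ereal R \<le> quarter_length k")
    case True
    then show ?thesis
      using arg quarter_length_cos_curv(2)[OF R True] c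
      unfolding section_length_def arccos_curv_le_quarter_length[OF k arg]
      by (simp add: eq[OF True])
  next
    case False
    then have kp: "k > 0" and "sqrt k * R > pi / 2"
      by (auto simp: quarter_length_def field_simps split: if_splits)
    then have "cos (min (sqrt k * R) pi) < cos (pi / 2)"
      using pi_gt_zero by (intro cos_monotone_0_pi) auto
    then have "cos (min (sqrt k * R) pi) < 0" by simp
    then have "max (-1) (cos (min (sqrt k * R) pi) / ?c) < 0"
      using c by (simp add: divide_neg_pos)
    then show ?thesis
      using False arg kp arccos_curv_le_quarter_length[OF k, of "max (-1) (cos (min (sqrt k * R) pi) / ?c)"]
      by (simp add: section_length_def)
  qed
qed

text \<open>In the comparison of \<open>cos_curv k R / cos_curv k h\<close> with
  \<open>cos_curv k r\<close> the two positive denominators can be exchanged. A lower bound on the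
  section radius thereby becomes an upper bound on the height, and this bound is
  \<open>alpha k R r\<close>. The strict bound on \<open>r\<close> makes \<open>cos_curv k r\<close>
  positive.\<close>

lemma hit_heights_eq:
  assumes k: "k \<noteq> 0" and r: "0 \<le> r" "ereal r < quarter_length k"
  shows "hit_heights k R {s. r < s \<and> ereal s \<le> quarter_length k} =
    (if r < R \<and> ereal R \<le> quarter_length k then {h. \<bar>h\<bar> < alpha k R r} else {})"
proof -
  have rs: "r \<in> half_strip k" using r by (simp add: half_strip_def)
  have cr: "cos_curv k r > 0" by (rule cos_curv_pos[OF rs])
  have rr: "arccos_curv k (cos_curv k r) = r"
    using arccos_curv_cos_curv_abs[OF k rs] r by simp
  have key: "r < section_length k (cos_curv k h) R \<longleftrightarrow>
      k * (cos_curv k R / cos_curv k r) < k * cos_curv k h"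
    if h: "h \<in> half_strip k" "\<bar>h\<bar> \<le> R" and R: "ereal R \<le> quarter_length k" for h
  proof -
    have ch: "cos_curv k h > 0" by (rule cos_curv_pos[OF h(1)])
    have "r < section_length k (cos_curv k h) R \<longleftrightarrow>
        \<not> arccos_curv k (cos_curv k R / cos_curv k h) \<le> arccos_curv k (cos_curv k r)"
      unfolding section_length_le_quarter(2)[OF k h R] rr not_le ..
    also have "\<dots> \<longleftrightarrow> k * (cos_curv k R / cos_curv k h) < k * cos_curv k r"
      unfolding arccos_curv_le_iff[OF k section_length_le_quarter(3)[OF k h R] cos_curv_values] not_le ..
    also have "\<dots> \<longleftrightarrow> k * (cos_curv k R / cos_curv k r) < k * cos_curv k h"
      using ch cr by (simp add: field_simps)
    finally show ?thesis .
  qed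
  show ?thesis
  proof (cases "r < R \<and> ereal R \<le> quarter_length k")
    case True
    then have R: "r < R" "ereal R \<le> quarter_length k" by auto
    have R0: "R \<ge> 0" using R r by simp
    note RQ = quarter_length_cos_curv[OF R0 R(2)]
    have val: "cos_curv k R / cos_curv k r \<in> cos_values k"
      using section_length_le_quarter(3)[OF k rs _ R(2)] R r by simp
    have alpha: "alpha k R r = arccos_curv k (cos_curv k R / cos_curv k r)"
      by (rule alpha_eq_arccos_curv[OF k])
    have "ereal (alpha k R r) \<le> quarter_length k"
      using RQ(2) cr by (simp add: alpha arccos_curv_le_quarter_length[OF k val])
    then have strip: "h \<in> half_strip k" if "\<bar>h\<bar> < alpha k R r" for h
      using that unfolding half_strip_def by (auto intro: less_le_trans[of _ "ereal (alpha k R r)"])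
    have "k * cos_curv k R \<le> k * (cos_curv k R / cos_curv k r)"
    proof -
      have "k * cos_curv k r \<le> k * 1" by (rule cos_values_le[OF cos_curv_values])
      then have "cos_curv k R * (k * cos_curv k r) \<le> cos_curv k R * (k * 1)"
        using RQ(2) by (rule mult_left_mono)
      then show ?thesis using cr by (simp add: field_simps)
    qed
    then have "alpha k R r \<le> arccos_curv k (cos_curv k R)"
      by (simp add: alpha arccos_curv_le_iff[OF k val cos_curv_values])
    \<comment> \<open>Hence the hitting condition in \<open>hit_heights\<close> follows from
      \<open>\<bar>h\<bar> < alpha k R r\<close> and leaves no trace in the result.\<close>
    then have alpha_le: "alpha k R r \<le> R" using arccos_curv_cos_curv[OF k RQ(1)] by simp
    have lt: "\<bar>h\<bar> < alpha k R r \<longleftrightarrow> k * (cos_curv k R / cos_curv k r) < k * cos_curv k h"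
      if "h \<in> half_strip k" for h
      using arccos_curv_le_iff[OF k val cos_curv_values, of h] arccos_curv_cos_curv_abs[OF k that]
      by (auto simp: alpha not_le[symmetric])
    show ?thesis
      unfolding if_P[OF True]
      using key[OF _ _ R(2)] lt strip alpha_le section_length_le_quarter(1)[OF k, of _ R] R(2)
      by (fastforce simp: hit_heights_def)
  next
    case False
    have "h \<notin> hit_heights k R {s. r < s \<and> ereal s \<le> quarter_length k}" for h
    proof
      assume "h \<in> hit_heights k R {s. r < s \<and> ereal s \<le> quarter_length k}"
      then have h: "h \<in> half_strip k" "\<bar>h\<bar> \<le> R" and s: "r < section_length k (cos_curv k h) R"
        and q: "ereal (section_length k (cos_curv k h) R) \<le> quarter_length k"
        by (auto simp: hit_heights_def)
      have R: "ereal R \<le> quarter_length k" using q section_length_le_quarter(1)[OF k h] by simp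
      \<comment> \<open>The section would now have a larger radius than the ball that it is cut
        from; the cosines contradict this.\<close>
      then have "R \<le> r" using False by simp
      have R0: "R \<ge> 0" using h by simp
      have "k * (cos_curv k R / cos_curv k r) < k * cos_curv k h" using key[OF h R] s by simp
      moreover have "k * cos_curv k h \<le> k * 1" by (rule cos_values_le[OF cos_curv_values])
      moreover have "k * cos_curv k r \<le> k * cos_curv k R"
        using cos_curv_le_iff[OF k quarter_length_cos_curv(1)[OF R0 R] half_strip_half_circle[OF rs]]
          r \<open>R \<le> r\<close> by simp
      then have "k * 1 \<le> k * (cos_curv k R / cos_curv k r)"
        using cr by (simp add: field_simps)
      ultimately show False by simp
    qed
    then show ?thesis unfolding if_not_P[OF False] by blast
  qed
qed

text \<open>Endpoints are null, so the open interval of \<open>hit_heights_eq\<close> and the closed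
  one of the theorem give the same integral. The bound by \<open>quarter_length k\<close> keeps the
  cosine nonnegative, so the Lebesgue integral agrees with the nonnegative one.\<close>

lemma nn_integral_cos_curv_power:
  assumes a: "0 \<le> a" "ereal a \<le> quarter_length k" and S: "S \<in> sets borel"
    and "{-a<..<a} \<subseteq> S" "S \<subseteq> {-a..a}"
  shows "(\<integral>\<^sup>+h\<in>S. ennreal (cos_curv k h ^ m) \<partial>lborel) = ennreal (LBINT h:{-a..a}. cos_curv k h ^ m)"
proof -
  have nn: "0 \<le> cos_curv k h ^ m" if "h \<in> {-a..a}" for h
  proof -
    have "ereal \<bar>h\<bar> \<le> ereal a" using that by auto
    then have "ereal \<bar>h\<bar> \<le> quarter_length k" using a(2) by (rule order_trans)
    then show ?thesis using quarter_length_cos_curv(2)[of "\<bar>h\<bar>" k] by simp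
  qed
  have "AE h in lborel. h \<noteq> a \<and> h \<noteq> - a"
    by (intro AE_conjI AE_lborel_singleton)
  then have "(\<integral>\<^sup>+h\<in>S. ennreal (cos_curv k h ^ m) \<partial>lborel) =
      (\<integral>\<^sup>+h\<in>{-a..a}. ennreal (cos_curv k h ^ m) \<partial>lborel)"
  proof (intro nn_integral_cong_AE, eventually_elim)
    case (elim h)
    then have "h \<in> S \<longleftrightarrow> h \<in> {-a..a}" using assms(4,5) by force
    then show ?case by (simp add: indicator_def)
  qed
  also have "\<dots> = (\<integral>\<^sup>+h. ennreal (indicator {-a..a} h *\<^sub>R cos_curv k h ^ m) \<partial>lborel)"
    by (intro nn_integral_cong) (simp add: indicator_def)
  also have "\<dots> = ennreal (LBINT h:{-a..a}. cos_curv k h ^ m)"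
    unfolding set_lebesgue_integral_def
  proof (rule nn_integral_eq_integral)
    show "integrable lborel (\<lambda>h. indicator {-a..a} h *\<^sub>R cos_curv k h ^ m)"
      unfolding set_integrable_def[symmetric]
      by (intro borel_integrable_atLeastAtMost' continuous_intros continuous_on_id)
  qed (use nn in \<open>auto simp: indicator_def\<close>)
  finally show ?thesis .
qed

theorem theorem4p1:
  fixes d :: nat and k N N' :: real
    and L :: "'n::finite ambient set"
    and \<mu> \<mu>\<^sub>L :: "'n ambient measure"
    and \<nu> \<nu>' :: "real measure"
    and P :: "'w measure"
    and \<eta> :: "'w \<Rightarrow> 'n ambient measure"
    and \<xi> :: "'w \<Rightarrow> ('n ambient \<times> real) measure"
  assumes "d \<ge> 2" and "CARD('n) = d" and "CARD('m::finite) = d - 1"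
    and "k \<noteq> 0"
    and "riemannian_volume TYPE('n) k (model_space k) \<mu>"
    and "totally_geodesic_hypersurface k L"
    and "riemannian_volume TYPE('m) k L \<mu>\<^sub>L"
    and "prob_space P"
    and "point_process P (restrict_space borel (model_space k)) \<eta>"
    and "isometry_invariant P k \<eta>"
    and "N > 0"
    and "has_intensity_measure P \<eta> (scale_measure (ennreal N) \<mu>)"
    and "radius_distribution \<nu>"
    and "independent_marking P (restrict_space borel (model_space k)) \<eta> \<nu> \<xi>"
    and "N' > 0"
    and "radius_distribution \<nu>'"
    and "has_intensity_measure P (induced_process k L \<xi>)
           (scale_measure (ennreal N') (\<mu>\<^sub>L \<Otimes>\<^sub>M \<nu>'))"
  shows "(\<forall>r. 0 \<le> r \<and> ereal r \<le> quarter_length k \<longrightarrow>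
            ennreal N' * emeasure \<nu>' {R. r < R \<and> ereal R \<le> quarter_length k} =
            ennreal N * (\<integral>\<^sup>+R\<in>{R. r < R \<and> ereal R \<le> quarter_length k}.
              ennreal (LBINT h:{- alpha k R r .. alpha k R r}. cos_curv k h ^ (d - 1)) \<partial>\<nu>))
       \<and> (emeasure \<nu> {R. ereal R > quarter_length k} = 0 \<longrightarrow>
            ennreal (N' / N) = (\<integral>\<^sup>+R\<in>{R. 0 < R \<and> ereal R \<le> quarter_length k}.
              ennreal (LBINT h:{- R .. R}. cos_curv k h ^ (d - 1)) \<partial>\<nu>))"
proof -
  note k = \<open>k \<noteq> 0\<close>
  obtain n where n: "form k n n = 1" "L = {x \<in> model_space k. form k x n = 0}"
    by (rule hypersurface_normal[OF k \<open>totally_geodesic_hypersurface k L\<close>])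
  interpret geodesic_hypersurface k n L
    using n k assms(1,2,6) by unfold_locales (auto simp: totally_geodesic_hypersurface_def)
  have \<nu>: "prob_space \<nu>" "sets \<nu> = sets borel" "AE R in \<nu>. 0 < R"
    and \<nu>': "prob_space \<nu>'" "sets \<nu>' = sets borel"
    using assms by (auto simp: radius_distribution_def)
  let ?l = "quarter_length k"
  let ?W = "\<lambda>R B. \<integral>\<^sup>+h\<in>hit_heights k R B. ennreal (cos_curv k h ^ (d - 1)) \<partial>lborel"
  have main: "ennreal N' * emeasure \<nu>' B = ennreal N * (\<integral>\<^sup>+R. ?W R B \<partial>\<nu>)" if "B \<in> sets borel" for B
    using radius_relation[OF _ assms(5,7,8) \<nu>(1,2) \<nu>' assms(14,12,17) that] assms(2,3) by simp
  show ?thesis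
  proof (intro conjI allI impI)
    fix r :: real assume r: "0 \<le> r \<and> ereal r \<le> ?l"
    let ?B = "{R. r < R \<and> ereal R \<le> ?l}"
    let ?I = "\<lambda>R. ennreal (LBINT h:{- alpha k R r .. alpha k R r}. cos_curv k h ^ (d - 1))"
    show "ennreal N' * emeasure \<nu>' ?B = ennreal N * (\<integral>\<^sup>+R\<in>?B. ?I R \<partial>\<nu>)"
    proof (cases "ereal r = ?l")
      case True
      \<comment> \<open>This boundary case occurs only on the sphere. There
        \<open>cos_curv k r\<close> is zero, so the quotient inside \<open>alpha\<close> carries no
        information, but both sides integrate over the empty set.\<close>
      have "?B = {}" unfolding True[symmetric] by auto
      then show ?thesis by (simp only: emeasure_empty) simp
    next
      case False
      with r have r: "0 \<le> r" "ereal r < ?l" by auto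
      have "?B \<in> sets borel" by measurable
      then have "ennreal N' * emeasure \<nu>' ?B = ennreal N * (\<integral>\<^sup>+R. ?W R ?B \<partial>\<nu>)" by (rule main)
      also have "(\<integral>\<^sup>+R. ?W R ?B \<partial>\<nu>) = (\<integral>\<^sup>+R\<in>?B. ?I R \<partial>\<nu>)"
      proof (rule nn_integral_cong)
        fix R
        show "?W R ?B = ?I R * indicator ?B R"
        proof (cases "R \<in> ?B")
          case True
          then have R: "r < R" "ereal R \<le> ?l" by auto
          have rs: "r \<in> half_strip k" using r by (simp add: half_strip_def)
          have val: "cos_curv k R / cos_curv k r \<in> cos_values k"
            using section_length_le_quarter(3)[OF k rs _ R(2)] R r by simp
          have "0 \<le> cos_curv k R / cos_curv k r"
            using quarter_length_cos_curv(2)[OF _ R(2)] cos_curv_pos[OF rs] R r by simp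
          then have "ereal (alpha k R r) \<le> ?l" "0 \<le> alpha k R r"
            using arccos_curv_le_quarter_length[OF k val] arccos_curv_nonneg[OF k val]
            by (simp_all add: alpha_eq_arccos_curv k)
          then have "(\<integral>\<^sup>+h\<in>{h. \<bar>h\<bar> < alpha k R r}. ennreal (cos_curv k h ^ (d - 1)) \<partial>lborel) = ?I R"
            by (intro nn_integral_cos_curv_power) auto
          then show ?thesis using True by (simp add: hit_heights_eq[OF k r])
        next
          case False
          then have "hit_heights k R ?B = {}" by (auto simp: hit_heights_eq[OF k r])
          then show ?thesis using False by simp
        qed
      qed
      finally show ?thesis .
    qed
  next
    assume big: "emeasure \<nu> {R. ereal R > ?l} = 0"
    have [measurable]: "{R. ereal R > ?l} \<in> sets \<nu>" unfolding \<nu>(2) by measurable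
    have "AE R in \<nu>. R \<notin> {R. ereal R > ?l}"
      using big by (intro AE_not_in) (auto simp: null_sets_def)
    with \<nu>(3) have AE: "AE R in \<nu>. 0 < R \<and> ereal R \<le> ?l" by eventually_elim auto
    \<comment> \<open>The relation for measures is applied to the whole line, not the first formula
      at \<open>r = 0\<close>: the total mass of \<open>\<nu>'\<close> is known to be 1, its mass on
      the positive radii up to \<open>quarter_length k\<close> is not yet.\<close>
    have "ennreal N' = ennreal N' * emeasure \<nu>' UNIV"
      using prob_space.emeasure_space_1[OF \<nu>'(1)] sets_eq_imp_space_eq[OF \<nu>'(2)] by simp
    also have "\<dots> = ennreal N * (\<integral>\<^sup>+R. ?W R UNIV \<partial>\<nu>)" by (rule main) simp
    also have "(\<integral>\<^sup>+R. ?W R UNIV \<partial>\<nu>) = (\<integral>\<^sup>+R\<in>{R. 0 < R \<and> ereal R \<le> ?l}.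
        ennreal (LBINT h:{- R .. R}. cos_curv k h ^ (d - 1)) \<partial>\<nu>)"
    proof (rule nn_integral_cong_AE, use AE in eventually_elim)
      case (elim R)
      \<comment> \<open>Only the open interval is claimed: if \<open>R\<close> equals the quarter
        circle, the endpoints are the poles, which \<open>hit_heights\<close> omits.\<close>
      have "{- R<..<R} \<subseteq> hit_heights k R UNIV"
      proof
        fix h assume h: "h \<in> {- R<..<R}"
        then have "ereal \<bar>h\<bar> < ereal R" by auto
        also have "\<dots> \<le> ?l" using elim by simp
        finally show "h \<in> hit_heights k R UNIV"
          using h by (auto simp: hit_heights_def half_strip_def)
      qed
      then have "?W R UNIV = ennreal (LBINT h:{- R .. R}. cos_curv k h ^ (d - 1))"
        using elim hit_heights_measurable[OF k, of UNIV R]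
        by (intro nn_integral_cos_curv_power) (auto simp: hit_heights_def)
      then show ?case using elim by simp
    qed
    finally have "ennreal N' = ennreal N * (\<integral>\<^sup>+R\<in>{R. 0 < R \<and> ereal R \<le> ?l}.
        ennreal (LBINT h:{- R .. R}. cos_curv k h ^ (d - 1)) \<partial>\<nu>)" (is "_ = _ * ?J") .
    then have "ennreal (1 / N) * ennreal N' = ennreal (1 / N) * (ennreal N * ?J)" by simp
    also have "\<dots> = ?J" using \<open>N > 0\<close> by (simp add: mult.assoc[symmetric] flip: ennreal_mult)
    finally show "ennreal (N' / N) = ?J"
      using \<open>N > 0\<close> \<open>N' > 0\<close> by (simp flip: ennreal_mult)
  qed
qed

end
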